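(* Let $\bar K$ be an algebraically closed field and let $R$ be a nonzero commutative $\bar K$-algebra of rank at most $6$ (i.e. $1\le \dim_{\bar K} R\le 6$). Then Alice (player A, the player who moves first) has a winning strategy in the Ideal Chomp Game on $R$, except if $R$ is isomorphic as a $\bar K$-algebra to one of the following five algebras, on which she has no winning strategy: $$\bar K,\qquad \bar K[x,y]/(x,y)^2,\qquad \bar K[x,y]/(xy,x^3,y^3),\qquad \bar K[x,y]/(x^2,xy^2,y^3),\qquad \bar K[x,y,z,w]/(x,y,z,w)^2.$$
   Context: All rings are commutative with $1$. The rank of a $\bar K$-algebra is its dimension as a $\bar K$-vector space. Ideal Chomp Game on a nonzero ring $R$: start with $I_0=(0)$. Players A (Alice) and B (Bob) alternately take turns, A first. In the $n$-th turn the current player chooses an element $a_n\in R\setminus I_{n-1}$ and sets $I_n=I_{n-1}+(a_n)$. The player who makes $I_n=R$ loses (and the other player wins). A player has a winning strategy if they can always force the other player to lose, whatever moves the other player makes. *)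

theory Defs
  imports
    "HOL-Computational_Algebra.Polynomial"
    "HOL-Library.Poly_Mapping"
    "HOL-Library.Numeral_Type"
begin

text \<open>
  A nonzero commutative algebra over a field is a type of class \<open>comm_ring_1\<close> (which includes
  \<open>0 \<noteq> 1\<close>) together with a compatible scalar multiplication.
\<close>

locale comm_algebra = vector_space scale
  for scale :: "'k::field \<Rightarrow> 'r::comm_ring_1 \<Rightarrow> 'r" +
  assumes scale_mult_left: "scale c x * y = scale c (x * y)"

text \<open>
  The library's dimension is \<open>0\<close> for a space without a finite basis, so a positive dimension
  includes finite-dimensionality.
\<close>

abbreviation algebra_rank :: "('k::field \<Rightarrow> 'r::comm_ring_1 \<Rightarrow> 'r) \<Rightarrow> nat" where
  "algebra_rank scale \<equiv> vector_space.dim scale UNIV"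

definition algebra_isomorphic ::
  "('k::field \<Rightarrow> 'r::comm_ring_1 \<Rightarrow> 'r) \<Rightarrow> ('k \<Rightarrow> 's::comm_ring_1 \<Rightarrow> 's) \<Rightarrow> bool" where
  "algebra_isomorphic scale1 scale2 \<longleftrightarrow>
     (\<exists>\<phi>. bij \<phi> \<and> \<phi> 1 = 1 \<and>
          (\<forall>x y. \<phi> (x + y) = \<phi> x + \<phi> y) \<and>
          (\<forall>x y. \<phi> (x * y) = \<phi> x * \<phi> y) \<and>
          (\<forall>c x. \<phi> (scale1 c x) = scale2 c (\<phi> x)))"

text \<open>Ideals are the submodules of the ring regarded as a module over itself.\<close>

definition ideal_gen :: "'r::comm_ring_1 set \<Rightarrow> 'r set" where
  "ideal_gen S = module.span (*) S"

definition ideal_sum :: "'r::comm_ring_1 set \<Rightarrow> 'r set \<Rightarrow> 'r set" where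
  "ideal_sum I J = {u + v | u v. u \<in> I \<and> v \<in> J}"

definition ideal_prod :: "'r::comm_ring_1 set \<Rightarrow> 'r set \<Rightarrow> 'r set" where
  "ideal_prod I J = ideal_gen {u * v | u v. u \<in> I \<and> v \<in> J}"

definition coset :: "'r::comm_ring_1 set \<Rightarrow> 'r \<Rightarrow> 'r set" where
  "coset I p = {p + u | u. u \<in> I}"

text \<open>
  The algebra \<open>P/I\<close> has the cosets of \<open>I\<close> as elements and the operations induced on representatives:
  \<open>[p] + [q] = [p + q]\<close>, \<open>[p] [q] = [p q]\<close>, \<open>c [p] = [c p]\<close>.  The predicate says that
  the algebra given by the second scalar multiplication is isomorphic to it.
\<close>

definition isomorphic_to_quotient ::
  "('k::field \<Rightarrow> 'p::comm_ring_1 \<Rightarrow> 'p) \<Rightarrow> 'p set \<Rightarrow> ('k \<Rightarrow> 'r::comm_ring_1 \<Rightarrow> 'r) \<Rightarrow> bool" where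
  "isomorphic_to_quotient scaleP I scale \<longleftrightarrow>
     (\<exists>\<phi>. bij_betw \<phi> (range (coset I)) UNIV \<and> \<phi> (coset I 1) = 1 \<and>
          (\<forall>p q. \<phi> (coset I (p + q)) = \<phi> (coset I p) + \<phi> (coset I q)) \<and>
          (\<forall>p q. \<phi> (coset I (p * q)) = \<phi> (coset I p) * \<phi> (coset I q)) \<and>
          (\<forall>c p. \<phi> (coset I (scaleP c p)) = scale c (\<phi> (coset I p))))"

text \<open>
  Polynomials over \<open>'k\<close> with one indeterminate for each element of \<open>'v\<close>: finitely supported
  functions from exponent vectors to coefficients, multiplied by convolution.
\<close>

type_synonym ('v, 'k) mpolys = "('v \<Rightarrow>\<^sub>0 nat) \<Rightarrow>\<^sub>0 'k"

definition mvar :: "'v \<Rightarrow> ('v, 'k::field) mpolys" where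
  "mvar v = Poly_Mapping.single (Poly_Mapping.single v 1) 1"

definition mscale :: "'k::field \<Rightarrow> ('v, 'k) mpolys \<Rightarrow> ('v, 'k) mpolys" where
  "mscale c p = Poly_Mapping.single 0 c * p"

text \<open>
  The numeral types \<open>2\<close> and \<open>4\<close> have two and four elements, so they index the indeterminates
  \<open>x, y\<close> and \<open>x, y, z, w\<close>, in this order.
\<close>

definition ideal_xy_squared :: "(2, 'k::field) mpolys set" where
  "ideal_xy_squared =
     (let m = ideal_gen {mvar 0, mvar 1} in ideal_prod m m)"

definition ideal_xy_x3_y3 :: "(2, 'k::field) mpolys set" where
  "ideal_xy_x3_y3 =
     (let x = mvar 0; y = mvar 1 in ideal_gen {x * y, x ^ 3, y ^ 3})"

definition ideal_x2_xy2_y3 :: "(2, 'k::field) mpolys set" where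
  "ideal_x2_xy2_y3 =
     (let x = mvar 0; y = mvar 1 in ideal_gen {x ^ 2, x * y ^ 2, y ^ 3})"

definition ideal_xyzw_squared :: "(4, 'k::field) mpolys set" where
  "ideal_xyzw_squared =
     (let m = ideal_gen {mvar 0, mvar 1, mvar 2, mvar 3} in ideal_prod m m)"

text \<open>
  A play is recorded as the list of the elements chosen so far, oldest first, so Alice chooses the
  entries with even index (counting from \<open>0\<close>).
\<close>

definition chomp_position :: "'r::comm_ring_1 list \<Rightarrow> 'r set" where
  "chomp_position as = foldl (\<lambda>I a. ideal_sum I (ideal_gen {a})) {0} as"

text \<open>There is no legal move once the position is the whole ring: the game is then over.\<close>

definition legal_play :: "'r::comm_ring_1 list \<Rightarrow> bool" where
  "legal_play as \<longleftrightarrow> (\<forall>n < length as. as ! n \<notin> chomp_position (take n as))"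

text \<open>A strategy maps the play so far to the next choice.\<close>

definition alice_follows :: "('r list \<Rightarrow> 'r) \<Rightarrow> 'r list \<Rightarrow> bool" where
  "alice_follows \<sigma> as \<longleftrightarrow> (\<forall>n < length as. even n \<longrightarrow> as ! n = \<sigma> (take n as))"

text \<open>
  A strategy is winning for Alice if, against all moves of Bob, it always supplies a legal move
  when it is her turn, every play that reaches the whole ring does so by a move of Bob (so it has
  even length), and the play does not go on for ever.
\<close>

definition alice_winning_strategy :: "('r::comm_ring_1 list \<Rightarrow> 'r) \<Rightarrow> bool" where
  "alice_winning_strategy \<sigma> \<longleftrightarrow>
     (\<forall>as. legal_play as \<and> alice_follows \<sigma> as \<longrightarrow>
        (if chomp_position as = UNIV then even (length as)
         else even (length as) \<longrightarrow> \<sigma> as \<notin> chomp_position as)) \<and>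
     \<not> (\<exists>f :: nat \<Rightarrow> 'r. \<forall>n. legal_play (map f [0..<n]) \<and> alice_follows \<sigma> (map f [0..<n]))"

definition alice_wins :: "'r::comm_ring_1 itself \<Rightarrow> bool" where
  "alice_wins _ \<longleftrightarrow> (\<exists>\<sigma> :: 'r list \<Rightarrow> 'r. alice_winning_strategy \<sigma>)"

end

theory Submission
  imports Defs
begin

text \<open>
  Call a proper ideal \<open>I\<close> losing if \<open>R/I\<close> is a loss for the player to move. For rank at most \<open>6\<close>
  these are the \<open>I\<close> for which \<open>R/I\<close> is local with Hilbert function \<open>(1)\<close>, \<open>(1,2)\<close>, \<open>(1,4)\<close> or \<open>(1,2,2)\<close>.
  Comparing dimensions, adjoining one element never leads from one of these to another. Conversely, if
  \<open>R/I\<close> is local with any other Hilbert function, a suitable element of the maximal ideal leads to one of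
  them. If \<open>R/I\<close> is not local, it has a nontrivial idempotent \<open>e\<close>; inductively there is a good
  move from \<open>I + (e)\<close> by some \<open>a\<close>, or \<open>I + (e)\<close> is itself losing, and since
  \<open>I + (e, a) = I + (e + (1 - e) a)\<close> either position is reached from \<open>I\<close> in one move.
  Finally the losing Hilbert functions determine the algebra, except that \<open>(1,2,2)\<close> has two
  algebras, according to whether the one quadratic relation is a product of distinct linear forms
  or a square.
\<close>

section \<open>The game on the ideals of a ring\<close>

text \<open>What separates the losing ideals is the parity of the embedding dimension dim m - dim P,
  where P = m^2 + I: it is even for them, and adjoining an element of m outside P lowers it by
  exactly one. Adjoining an element of P keeps it, but then cuts (1,2,2) down to (1,2,1). Rank 6
  means dim m is at most 5, so few other Hilbert functions remain, and only (1,3,2) resists a direct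
  choice of move. There multiplication is a symmetric bilinear map from m into the plane P/I, and
  Alice needs an element outside P of rank 0 (leaving (1,2,2)) or of rank 2 (leaving (1,2)). In
  several other cases Nakayama's lemma turns a generator modulo a higher power of m into an actual
  generator. Algebraic closedness enters twice: maximal ideals have residue field K, so R = K + m,
  and binary quadratic forms factor. On the polynomial side all four quotients are by monomial
  ideals, so an isomorphism amounts to a basis of R indexed by the standard monomials and multiplied
  like them.\<close>

definition is_ideal :: "'r::comm_ring_1 set \<Rightarrow> bool" where
  "is_ideal I \<longleftrightarrow> 0 \<in> I \<and> (\<forall>x\<in>I. \<forall>y\<in>I. x + y \<in> I) \<and> (\<forall>r. \<forall>x\<in>I. r * x \<in> I)"

definition adjoin :: "'r::comm_ring_1 set \<Rightarrow> 'r \<Rightarrow> 'r set" where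
  "adjoin I a = {u + r * a | u r. u \<in> I}"

lemma module_mult: "module ((*) :: 'r::comm_ring_1 \<Rightarrow> 'r \<Rightarrow> 'r)"
  by unfold_locales (simp_all add: algebra_simps)

lemma is_ideal_subspace: "is_ideal I \<longleftrightarrow> module.subspace (*) (I :: 'r::comm_ring_1 set)"
  unfolding is_ideal_def module.subspace_def[OF module_mult] by blast

lemma ideal_sum_gen: "ideal_sum I (ideal_gen {a}) = adjoin I a"
  unfolding ideal_sum_def ideal_gen_def adjoin_def module.span_singleton[OF module_mult] by auto

lemma is_idealD:
  assumes "is_ideal I"
  shows "0 \<in> I" "x \<in> I \<Longrightarrow> y \<in> I \<Longrightarrow> x + y \<in> I" "x \<in> I \<Longrightarrow> r * x \<in> I" "x \<in> I \<Longrightarrow> x * r \<in> I"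
    "x \<in> I \<Longrightarrow> - x \<in> I" "x \<in> I \<Longrightarrow> y \<in> I \<Longrightarrow> x - y \<in> I"
proof -
  show *: "0 \<in> I" "x \<in> I \<Longrightarrow> y \<in> I \<Longrightarrow> x + y \<in> I" "x \<in> I \<Longrightarrow> r * x \<in> I" for x y r
    using assms unfolding is_ideal_def by blast+
  show "x \<in> I \<Longrightarrow> x * r \<in> I" using *(3)[of x r] by (simp add: mult.commute)
  show neg: "x \<in> I \<Longrightarrow> - x \<in> I" for x using *(3)[of x "-1"] by simp
  show "x \<in> I \<Longrightarrow> y \<in> I \<Longrightarrow> x - y \<in> I" using *(2)[of x "-y"] neg[of y] by simp
qed

lemma is_ideal_eq_UNIV: "is_ideal I \<Longrightarrow> 1 \<in> I \<Longrightarrow> I = UNIV"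
  using is_idealD(3)[of I 1] by auto

lemma is_ideal_zero: "is_ideal {0}"
  unfolding is_ideal_def by simp

lemma is_ideal_adjoin:
  assumes "is_ideal I" shows "is_ideal (adjoin I a)"
  unfolding is_ideal_def
proof (intro conjI ballI allI)
  show "0 \<in> adjoin I a" unfolding adjoin_def
    using is_idealD(1)[OF assms] by (auto intro!: exI[of _ 0])
  fix x assume "x \<in> adjoin I a"
  then obtain u r where x: "x = u + r * a" "u \<in> I" unfolding adjoin_def by blast
  have "s * x = s * u + (s * r) * a" for s using x by (simp add: algebra_simps)
  then show "s * x \<in> adjoin I a" for s unfolding adjoin_def using is_idealD(3)[OF assms x(2)] by blast
  fix y assume "y \<in> adjoin I a"
  then obtain v s where y: "y = v + s * a" "v \<in> I" unfolding adjoin_def by blast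
  have "x + y = (u + v) + (r + s) * a" using x y by (simp add: algebra_simps)
  then show "x + y \<in> adjoin I a"
    unfolding adjoin_def using is_idealD(2)[OF assms x(2) y(2)] by blast
qed

lemma subset_adjoin: "I \<subseteq> adjoin I a"
proof
  fix x assume "x \<in> I"
  then show "x \<in> adjoin I a" unfolding adjoin_def by (intro CollectI exI[of _ x] exI[of _ 0]) simp
qed

lemma self_in_adjoin: assumes "is_ideal I" shows "a \<in> adjoin I a"
  unfolding adjoin_def using is_idealD(1)[OF assms] by (intro CollectI exI[of _ 0] exI[of _ 1]) simp

lemma adjoin_minimal:
  assumes "is_ideal J" "I \<subseteq> J" "a \<in> J" shows "adjoin I a \<subseteq> J"
  unfolding adjoin_def using is_idealD(2,3)[OF assms(1)] assms(2,3) by blast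

section \<open>Plays as increasing chains of ideals\<close>

lemma chomp_position_Nil: "chomp_position [] = {0}"
  by (simp add: chomp_position_def)

lemma chomp_position_snoc: "chomp_position (as @ [a]) = adjoin (chomp_position as) a"
  by (simp add: chomp_position_def ideal_sum_gen)

lemma is_ideal_chomp_position: "is_ideal (chomp_position as)"
  by (induction as rule: rev_induct)
    (simp_all add: chomp_position_Nil chomp_position_snoc is_ideal_zero is_ideal_adjoin)

lemma legal_play_snoc:
  "legal_play (as @ [a]) \<longleftrightarrow> legal_play as \<and> a \<notin> chomp_position as"
  unfolding legal_play_def by (auto simp: nth_append less_Suc_eq)

lemma alice_follows_snoc:
  "alice_follows \<sigma> (as @ [a]) \<longleftrightarrow> alice_follows \<sigma> as \<and> (even (length as) \<longrightarrow> a = \<sigma> as)"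
  unfolding alice_follows_def by (auto simp: nth_append less_Suc_eq)

text \<open>Each legal move raises \<open>d\<close>. Later \<open>d\<close> is the dimension, so
  that its bound ends every play.\<close>

lemma legal_play_length_le:
  fixes d :: "'r::comm_ring_1 set \<Rightarrow> nat"
  assumes "\<And>I a. is_ideal I \<Longrightarrow> a \<notin> I \<Longrightarrow> d I < d (adjoin I a)"
    and "legal_play as"
  shows "length as \<le> d (chomp_position as)"
  using assms(2)
proof (induction as rule: rev_induct)
  case (snoc a as)
  then show ?case
    using assms(1)[OF is_ideal_chomp_position, of a as]
    by (simp add: legal_play_snoc chomp_position_snoc)
qed simp

text \<open>\<open>L\<close> is the kernel of the game graph: no move stays inside it, and from
  every other proper ideal some move enters it. The whole ring lies outside \<open>L\<close> because
  whoever would have to move there has just won. Conversely, Bob can drag any strategy that starts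
  in \<open>L\<close> back into \<open>L\<close> after each of his moves, so a winning one would
  give plays longer than the bound on \<open>d\<close> allows.\<close>

lemma alice_wins_iff:
  fixes L :: "'r::comm_ring_1 set set" and d :: "'r set \<Rightarrow> nat"
  assumes strict: "\<And>I a. is_ideal I \<Longrightarrow> a \<notin> I \<Longrightarrow> d I < d (adjoin I a)"
    and bounded: "\<And>I. d I \<le> N"
    and "UNIV \<notin> L"
    and L_out: "\<And>I a. is_ideal I \<Longrightarrow> I \<in> L \<Longrightarrow> a \<notin> I \<Longrightarrow> adjoin I a \<notin> L"
    and L_in: "\<And>I. is_ideal I \<Longrightarrow> I \<notin> L \<Longrightarrow> I \<noteq> UNIV \<Longrightarrow> \<exists>a. a \<notin> I \<and> adjoin I a \<in> L"
  shows "alice_wins TYPE('r) \<longleftrightarrow> {0} \<notin> L"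
proof
  assume start: "{0} \<notin> L"
  define \<sigma> :: "'r list \<Rightarrow> 'r" where
    "\<sigma> as = (SOME a. a \<notin> chomp_position as \<and> adjoin (chomp_position as) a \<in> L)" for as
  have \<sigma>: "\<sigma> as \<notin> chomp_position as \<and> adjoin (chomp_position as) (\<sigma> as) \<in> L"
    if "chomp_position as \<notin> L" "chomp_position as \<noteq> UNIV" for as
    unfolding \<sigma>_def by (rule someI_ex) (rule L_in[OF is_ideal_chomp_position that])
  \<comment> \<open>Alice always moves into \<open>L\<close> and Bob always out of it. So the whole
    ring, being outside \<open>L\<close>, is reached only at even length, that is by Bob.\<close>
  have inv: "chomp_position as \<in> L \<longleftrightarrow> odd (length as)"
    if "legal_play as" "alice_follows \<sigma> as" for as
    using that
  proof (induction as rule: rev_induct)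
    case Nil
    then show ?case using start by (simp add: chomp_position_Nil)
  next
    case (snoc a as)
    then have IH: "chomp_position as \<in> L \<longleftrightarrow> odd (length as)" and a: "a \<notin> chomp_position as"
      and f: "even (length as) \<longrightarrow> a = \<sigma> as"
      by (simp_all add: legal_play_snoc alice_follows_snoc)
    show ?case
    proof (cases "even (length as)")
      case True
      then show ?thesis using IH f \<sigma>[of as] a by (auto simp: chomp_position_snoc)
    next
      case False
      then show ?thesis
        using IH L_out[OF is_ideal_chomp_position _ a] by (simp add: chomp_position_snoc)
    qed
  qed
  have "alice_winning_strategy \<sigma>"
    unfolding alice_winning_strategy_def
  proof (intro conjI allI impI)
    fix as assume as: "legal_play as \<and> alice_follows \<sigma> as"
    show "if chomp_position as = UNIV then even (length as)
         else even (length as) \<longrightarrow> \<sigma> as \<notin> chomp_position as"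
      using inv[of as] as \<sigma>[of as] \<open>UNIV \<notin> L\<close> by auto
  next
    show "\<nexists>f. \<forall>n. legal_play (map f [0..<n]) \<and> alice_follows \<sigma> (map f [0..<n])"
    proof
      assume "\<exists>f. \<forall>n. legal_play (map f [0..<n]) \<and> alice_follows \<sigma> (map f [0..<n])"
      then obtain f :: "nat \<Rightarrow> 'r" where "legal_play (map f [0..<n])" for n by blast
      from legal_play_length_le[OF strict this, of "Suc N"] bounded show False
        by (metis diff_zero length_map length_upt not_less_eq_eq order_trans)
    qed
  qed
  then show "alice_wins TYPE('r)" unfolding alice_wins_def by blast
next
  assume "alice_wins TYPE('r)"
  then obtain \<sigma> :: "'r list \<Rightarrow> 'r" where "alice_winning_strategy \<sigma>" unfolding alice_wins_def by blast
  then have win: "if chomp_position as = UNIV then even (length as)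
         else even (length as) \<longrightarrow> \<sigma> as \<notin> chomp_position as"
    if "legal_play as" "alice_follows \<sigma> as" for as
    using that unfolding alice_winning_strategy_def by blast
  show "{0} \<notin> L"
  proof
    assume start: "{0} \<in> L"
    have "\<exists>as. legal_play as \<and> alice_follows \<sigma> as \<and> length as = 2 * k \<and> chomp_position as \<in> L" for k
    proof (induction k)
      case 0
      have "legal_play []" "alice_follows \<sigma> []" by (simp_all add: legal_play_def alice_follows_def)
      then show ?case using start by (intro exI[of _ "[]"]) (simp add: chomp_position_Nil)
    next
      case (Suc k)
      then obtain as where as: "legal_play as" "alice_follows \<sigma> as" "length as = 2 * k"
        "chomp_position as \<in> L" by blast
      then have a: "\<sigma> as \<notin> chomp_position as" using win[OF as(1,2)] as(3) \<open>UNIV \<notin> L\<close> by (metis even_mult_iff even_numeral as(4))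
      let ?bs = "as @ [\<sigma> as]"
      have bs: "legal_play ?bs" "alice_follows \<sigma> ?bs"
        using as a by (simp_all add: legal_play_snoc alice_follows_snoc)
      have "chomp_position ?bs \<notin> L"
        using L_out[OF is_ideal_chomp_position as(4) a] by (simp add: chomp_position_snoc)
      \<comment> \<open>The length is odd here, so reaching the whole ring would be Alice's own
        loss.\<close>
      moreover have "chomp_position ?bs \<noteq> UNIV" using win[OF bs] as(3) by auto
      ultimately obtain b where b: "b \<notin> chomp_position ?bs" "adjoin (chomp_position ?bs) b \<in> L"
        using L_in[OF is_ideal_chomp_position] by blast
      have "legal_play (?bs @ [b])" "alice_follows \<sigma> (?bs @ [b])"
        using bs b(1) as(3) by (simp_all only: legal_play_snoc[of ?bs] alice_follows_snoc[of _ ?bs]) simp_all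
      moreover have "length (?bs @ [b]) = 2 * Suc k" using as(3) by simp
      moreover have "chomp_position (?bs @ [b]) \<in> L"
        using b(2) by (simp only: chomp_position_snoc[of ?bs])
      ultimately show ?case by blast
    qed
    from this[of "Suc N"] obtain as :: "'r list" where "legal_play as" "length as = 2 * Suc N" by blast
    from legal_play_length_le[OF strict this(1)] this(2) bounded[of "chomp_position as"]
    show False by simp
  qed
qed

section \<open>Ideals of a finite-dimensional algebra\<close>

locale fin_comm_algebra = comm_algebra scale + finite_dimensional_vector_space scale Basis
  for scale :: "'k::field \<Rightarrow> 'r::comm_ring_1 \<Rightarrow> 'r" and Basis
begin

lemma mult_scale_right: "x * scale c y = scale c (x * y)"
  using scale_mult_left[of c y x] by (simp add: mult.commute)

lemma scale_conv_mult: "scale c x = scale c 1 * x"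
  by (simp add: scale_mult_left)

lemma is_ideal_scale: "is_ideal I \<Longrightarrow> x \<in> I \<Longrightarrow> scale c x \<in> I"
  by (subst scale_conv_mult) (rule is_idealD(3))

lemma subspace_ideal: "is_ideal I \<Longrightarrow> subspace I"
  unfolding subspace_def using is_idealD(1,2) is_ideal_scale by blast

lemma is_ideal_span:
  assumes "\<And>r x. x \<in> S \<Longrightarrow> r * x \<in> span S"
  shows "is_ideal (span S)"
proof -
  have "r * x \<in> span S" if "x \<in> span S" for r x
    using that
  proof (induction rule: span_induct)
    case base
    show ?case
      by (simp add: subspace_def span_zero span_add distrib_left mult_scale_right span_scale)
  qed (rule assms)
  then show ?thesis unfolding is_ideal_def using span_zero span_add by blast
qed

lemma dim_subspace_less: "subspace A \<Longrightarrow> subspace B \<Longrightarrow> A \<subset> B \<Longrightarrow> dim A < dim B"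
  using dim_psubset[of A B] span_eq_iff by metis

lemma dim_ideal_le: "is_ideal I \<Longrightarrow> dim I \<le> dimension"
  by (rule dim_subset_UNIV)

lemma dim_adjoin_less: "is_ideal I \<Longrightarrow> a \<notin> I \<Longrightarrow> dim I < dim (adjoin I a)"
  using dim_subspace_less[of I "adjoin I a"] subspace_ideal is_ideal_adjoin subset_adjoin
    self_in_adjoin by blast

lemma span_insert_subset:
  assumes "subspace J" "I \<subseteq> J" "a \<in> J" shows "span (insert a I) \<subseteq> J"
  using assms by (intro span_minimal) auto

lemma dim_span_insert:
  assumes "subspace I" "a \<notin> I" shows "dim (span (insert a I)) = dim I + 1"
  using assms by (simp add: dim_insert span_eq_iff[THEN iffD2])

lemma span_insert_subspace:
  assumes "subspace I"
  shows "x \<in> span (insert a I) \<longleftrightarrow> (\<exists>c. x - scale c a \<in> I)"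
  using assms by (simp add: span_breakdown_eq span_eq_iff[THEN iffD2])

lemma is_ideal_chain_max:
  assumes "is_ideal I" "Pr I"
  obtains J where "is_ideal J" "Pr J" "\<And>J'. is_ideal J' \<Longrightarrow> Pr J' \<Longrightarrow> dim J' \<le> dim J"
proof -
  have "\<exists>J. (is_ideal J \<and> Pr J) \<and> (\<forall>J'. (is_ideal J' \<and> Pr J') \<longrightarrow> dim J' \<le> dim J)"
    by (rule ex_has_greatest_nat[of _ I _ "dimension + 1"])
      (use assms dim_ideal_le in \<open>auto intro: le_imp_less_Suc\<close>)
  then show thesis using that by blast
qed

text \<open>This is AB + I. A linear span suffices, since an ideal \<open>A\<close> absorbs ring
  multiples. With A = B = m it is m^2 + I, and \<open>B\<close> may also be a mere set:
  \<open>prod_mod m {a} I\<close> is ma + I, the image of multiplication by a.\<close>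

definition prod_mod :: "'r set \<Rightarrow> 'r set \<Rightarrow> 'r set \<Rightarrow> 'r set" where
  "prod_mod A B I = span ({u * v | u v. u \<in> A \<and> v \<in> B} \<union> I)"

lemma prod_mod_mult: "u \<in> A \<Longrightarrow> v \<in> B \<Longrightarrow> u * v \<in> prod_mod A B I"
  unfolding prod_mod_def by (intro span_base) blast

lemma subset_prod_mod: "I \<subseteq> prod_mod A B I"
  unfolding prod_mod_def using span_superset by blast

lemma prod_mod_minimal:
  assumes "subspace Q" "I \<subseteq> Q" "\<And>u v. u \<in> A \<Longrightarrow> v \<in> B \<Longrightarrow> u * v \<in> Q"
  shows "prod_mod A B I \<subseteq> Q"
  unfolding prod_mod_def using assms by (intro span_minimal) auto

lemma prod_mod_mono: "B \<subseteq> B' \<Longrightarrow> I \<subseteq> J \<Longrightarrow> prod_mod A B I \<subseteq> prod_mod A B' J"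
  unfolding prod_mod_def by (intro span_mono) blast

text \<open>Used when Alice moves inside m^2 + I: the degree one part of the quotient then stays the
  same.\<close>

lemma prod_mod_absorb:
  assumes "I \<subseteq> J" "J \<subseteq> prod_mod A B I" shows "prod_mod A B J = prod_mod A B I"
proof
  show "prod_mod A B J \<subseteq> prod_mod A B I"
    using assms(2) by (intro prod_mod_minimal prod_mod_mult) (auto simp: prod_mod_def)
qed (use assms(1) in \<open>intro prod_mod_mono order_refl\<close>)

lemma is_ideal_prod_mod:
  assumes "is_ideal A" "is_ideal I" shows "is_ideal (prod_mod A B I)"
  unfolding prod_mod_def
proof (rule is_ideal_span)
  fix r x assume "x \<in> {u * v |u v. u \<in> A \<and> v \<in> B} \<union> I"
  then show "r * x \<in> span ({u * v |u v. u \<in> A \<and> v \<in> B} \<union> I)"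
  proof
    assume "x \<in> {u * v |u v. u \<in> A \<and> v \<in> B}"
    then obtain u v where x: "x = u * v" "u \<in> A" "v \<in> B" by blast
    have "r * x = (r * u) * v" using x by (simp add: mult.assoc)
    then show ?thesis using is_idealD(3)[OF assms(1) x(2)] x(3) by (intro span_base) blast
  qed (auto intro!: span_base is_idealD(3)[OF assms(2)])
qed

text \<open>Over an algebraically closed field these are exactly the maximal ideals.\<close>

definition max_ideal :: "'r set \<Rightarrow> bool" where
  "max_ideal m \<longleftrightarrow> is_ideal m \<and> 1 \<notin> m \<and> (\<forall>r. \<exists>c. r - scale c 1 \<in> m)"

lemma max_idealE:
  assumes "max_ideal m"
  obtains c t where "r = scale c 1 + t" "t \<in> m"
  using assms unfolding max_ideal_def by (metis add.commute diff_add_cancel)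

lemma max_ideal_scale_one:
  assumes "max_ideal m" "scale c 1 \<in> m" shows "c = 0"
proof (rule ccontr)
  assume "c \<noteq> 0"
  then have "1 = scale (inverse c) (scale c 1)" by simp
  then show False using is_ideal_scale assms unfolding max_ideal_def by metis
qed

lemma max_ideal_prime:
  assumes m: "max_ideal m" and xy: "x * y \<in> m" shows "x \<in> m \<or> y \<in> m"
proof -
  have i: "is_ideal m" using m unfolding max_ideal_def by blast
  obtain c s where x: "x = scale c 1 + s" "s \<in> m" using max_idealE[OF m] .
  obtain d t where y: "y = scale d 1 + t" "t \<in> m" using max_idealE[OF m] .
  have "scale (c * d) 1 = x * y - s * y - scale c 1 * t"
    unfolding x y by (simp add: algebra_simps scale_mult_left mult_scale_right)
  also have "\<dots> \<in> m" using is_idealD(3,4,6)[OF i] xy x y by simp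
  finally have "c * d = 0" by (rule max_ideal_scale_one[OF m])
  then show ?thesis using x y by auto
qed

lemma max_ideal_eqI:
  assumes m: "max_ideal m" and m': "max_ideal m'" and sub: "m \<subseteq> m'" shows "m = m'"
proof
  show "m' \<subseteq> m"
  proof
    fix x assume x: "x \<in> m'"
    obtain c t where ct: "x = scale c 1 + t" "t \<in> m" using max_idealE[OF m] .
    then have "scale c 1 = x - t" by simp
    also have "\<dots> \<in> m'" using x ct sub m' is_idealD(6) unfolding max_ideal_def by blast
    finally have "c = 0" by (rule max_ideal_scale_one[OF m'])
    then show "x \<in> m" using ct by simp
  qed
qed (rule sub)

text \<open>Because R = K + m, the multiples of \<open>a\<close> contribute only the line of
  \<open>a\<close> once ma lies in \<open>Q\<close>. This is the source of the upper bounds on what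
  a single move adds.\<close>

lemma adjoin_subset_span_insert:
  assumes m: "max_ideal m" and Q: "subspace Q" and "I \<subseteq> Q" "\<And>t. t \<in> m \<Longrightarrow> t * a \<in> Q"
  shows "adjoin I a \<subseteq> span (insert a Q)"
proof
  fix x assume "x \<in> adjoin I a"
  then obtain u r where x: "x = u + r * a" "u \<in> I" unfolding adjoin_def by blast
  obtain c t where r: "r = scale c 1 + t" "t \<in> m" using max_idealE[OF m] .
  have "x - scale c a = u + t * a" unfolding x r by (simp add: algebra_simps mult_scale_right)
  also have "\<dots> \<in> Q" using assms x r subspace_add by blast
  finally show "x \<in> span (insert a Q)" using span_insert_subspace[OF Q] by blast
qed

lemma adjoin_eq_span_insert:
  assumes "max_ideal m" "is_ideal I" "\<And>t. t \<in> m \<Longrightarrow> t * a \<in> I"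
  shows "adjoin I a = span (insert a I)"
proof
  show "adjoin I a \<subseteq> span (insert a I)"
    using adjoin_subset_span_insert[OF assms(1) subspace_ideal[OF assms(2)]] assms(3) by blast
  show "span (insert a I) \<subseteq> adjoin I a"
    by (intro span_insert_subset subspace_ideal is_ideal_adjoin subset_adjoin self_in_adjoin assms(2))
qed

text \<open>Take an ideal \<open>M\<close> of largest dimension among those containing
  \<open>Q\<close> and properly contained in \<open>P\<close>. For t in \<open>m\<close>, the ideal
  M + tP is \<open>M\<close> or \<open>P\<close>. In the latter case P = M + t^k P for all k, and
  some t^k in \<open>Q\<close> forces P = M. Hence tP lies in \<open>M\<close> for every t, so mP +
  Q does too, contradicting \<open>sub\<close>.\<close>

lemma nakayama:
  assumes P: "is_ideal P" and Q: "is_ideal Q" and "Q \<subseteq> P"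
    and nil: "\<And>t. t \<in> m \<Longrightarrow> \<exists>k. t ^ k \<in> Q"
    and sub: "P \<subseteq> prod_mod m P Q"
  shows "P = Q"
proof (rule ccontr)
  assume "P \<noteq> Q"
  then have "Q \<subseteq> Q \<and> Q \<subset> P" using \<open>Q \<subseteq> P\<close> by blast
  then obtain M where M: "is_ideal M" "Q \<subseteq> M \<and> M \<subset> P"
    and M_max: "\<And>J. is_ideal J \<Longrightarrow> Q \<subseteq> J \<and> J \<subset> P \<Longrightarrow> dim J \<le> dim M"
    using is_ideal_chain_max[where Pr = "\<lambda>J. Q \<subseteq> J \<and> J \<subset> P", OF Q] by metis
  have "t * p \<in> M" if t: "t \<in> m" and p: "p \<in> P" for t p
  proof -
    define T where "T = {q + t * x | q x. q \<in> M \<and> x \<in> P}"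
    have T: "is_ideal T"
      unfolding is_ideal_def
    proof (intro conjI ballI allI)
      show "0 \<in> T" unfolding T_def using is_idealD(1)[OF M(1)] is_idealD(1)[OF P] by force
      fix y assume "y \<in> T"
      then obtain q x where y: "y = q + t * x" "q \<in> M" "x \<in> P" unfolding T_def by blast
      have "r * y = r * q + t * (r * x)" for r using y by (simp add: algebra_simps)
      then show "r * y \<in> T" for r unfolding T_def using is_idealD(3)[OF M(1)] is_idealD(3)[OF P] y by blast
      fix z assume "z \<in> T"
      then obtain q' x' where z: "z = q' + t * x'" "q' \<in> M" "x' \<in> P" unfolding T_def by blast
      have "y + z = (q + q') + t * (x + x')" using y z by (simp add: algebra_simps)
      then show "y + z \<in> T" unfolding T_def using is_idealD(2)[OF M(1)] is_idealD(2)[OF P] y z by blast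
    qed
    have MT: "M \<subseteq> T"
    proof
      fix q assume "q \<in> M"
      then show "q \<in> T" unfolding T_def using is_idealD(1)[OF P] by force
    qed
    have TP: "T \<subseteq> P" unfolding T_def using M is_idealD(2,3)[OF P] by blast
    have "T \<noteq> P"
    proof
      assume TP: "T = P"
      have "\<exists>q\<in>M. \<exists>x'\<in>P. x = q + t ^ k * x'" if "x \<in> P" for k x
        using that
      proof (induction k)
        case 0
        then show ?case using is_idealD(1)[OF M(1)] by force
      next
        case (Suc k)
        then obtain q x' where q: "q \<in> M" "x' \<in> P" "x = q + t ^ k * x'" by blast
        then obtain q' x'' where q': "q' \<in> M" "x'' \<in> P" "x' = q' + t * x''" using TP unfolding T_def by blast
        have "x = (q + t ^ k * q') + t ^ Suc k * x''" unfolding q q' by (simp add: algebra_simps)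
        then show ?case using q q' is_idealD(2,3)[OF M(1)] by blast
      qed
      note expand = this
      obtain k where k: "t ^ k \<in> M" using nil[OF t] M(2) by blast
      have "P \<subseteq> M"
      proof
        fix x assume "x \<in> P"
        then obtain q x' where "q \<in> M" "x = q + t ^ k * x'" using expand[of x k] by blast
        then show "x \<in> M" using is_idealD(2)[OF M(1)] is_idealD(4)[OF M(1) k] by simp
      qed
      then show False using M by blast
    qed
    then have "dim T \<le> dim M" using M_max[OF T] MT TP M by blast
    then have "T = M" using dim_subspace_less[OF subspace_ideal[OF M(1)] subspace_ideal[OF T]] MT by auto
    moreover have "0 + t * p \<in> T" unfolding T_def using p is_idealD(1)[OF M(1)] by blast
    ultimately show ?thesis by simp
  qed
  then have "prod_mod m P Q \<subseteq> M" using M by (intro prod_mod_minimal subspace_ideal) auto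
  then show False using sub M by blast
qed

text \<open>The chain I + (t), I + (t^2), ... stabilises. For a power p that gives the least
  dimension, p is congruent to s p^2 modulo \<open>I\<close>; then s p is idempotent modulo
  \<open>I\<close> and acts on p as the identity.\<close>

lemma idempotent_mod:
  fixes t :: 'r
  assumes I: "is_ideal I"
  obtains k s where "k > 0" "t ^ k - t ^ k * (s * t ^ k) \<in> I"
    "(s * t ^ k) * (s * t ^ k) - s * t ^ k \<in> I"
proof -
  \<comment> \<open>Indexing by \<open>Suc k\<close> makes the exponent positive, so that the power
    lies in every ideal containing t.\<close>
  have "\<exists>k. True \<and> (\<forall>j. True \<longrightarrow> dim (adjoin I (t ^ Suc k)) \<le> dim (adjoin I (t ^ Suc j)))"
    by (rule ex_has_least_nat[of _ 0]) simp
  then obtain k where k: "\<And>j. dim (adjoin I (t ^ Suc k)) \<le> dim (adjoin I (t ^ Suc j))"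
    by blast
  define p where "p = t ^ Suc k"
  have p2: "p * p = t ^ Suc (k + k + 1)" unfolding p_def by (simp add: power_add mult_ac)
  have "adjoin I (p * p) \<subseteq> adjoin I p"
    by (intro adjoin_minimal is_ideal_adjoin subset_adjoin I is_idealD(3) self_in_adjoin)
  moreover have "dim (adjoin I p) \<le> dim (adjoin I (p * p))"
    using k[of "k + k + 1"] unfolding p2 unfolding p_def .
  ultimately have "adjoin I (p * p) = adjoin I p"
    by (intro subspace_dim_equal subspace_ideal is_ideal_adjoin I)
  then have "p \<in> adjoin I (p * p)" using self_in_adjoin[OF I] by blast
  then obtain u s where us: "p = u + s * (p * p)" "u \<in> I" unfolding adjoin_def by blast
  have u: "p - p * (s * p) = u" using us(1) by (simp add: algebra_simps)
  then have "(s * p) * (s * p) - s * p = - s * u" by (simp add: algebra_simps flip: u)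
  then have "(s * p) * (s * p) - s * p \<in> I" using is_idealD(3)[OF I us(2), of "- s"] by simp
  moreover have "p - p * (s * p) \<in> I" using u us(2) by simp
  ultimately show thesis using that[of "Suc k" s] unfolding p_def by blast
qed

end

section \<open>Losing ideals\<close>

context fin_comm_algebra
begin

text \<open>The Hilbert functions \<open>(1)\<close>, \<open>(1,2)\<close>, \<open>(1,4)\<close> and \<open>(1,2,2)\<close> of the local algebra \<open>R/I\<close>.\<close>

definition losing_at :: "'r set \<Rightarrow> 'r set \<Rightarrow> bool" where
  "losing_at m I \<longleftrightarrow> I = m \<or>
    I \<subseteq> m \<and> (\<forall>x\<in>m. \<forall>p\<in>prod_mod m m I. x * p \<in> I) \<and>
    (let P = prod_mod m m I in
      dim m = dim P + 2 \<and> P = I \<or> dim m = dim P + 4 \<and> P = I \<or> dim m = dim P + 2 \<and> dim P = dim I + 2)"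

definition losing :: "'r set \<Rightarrow> bool" where
  "losing I \<longleftrightarrow> (\<exists>m. max_ideal m \<and> losing_at m I)"

lemma not_losing_UNIV: "\<not> losing UNIV"
  unfolding losing_def losing_at_def max_ideal_def by auto

lemma losing_max_ideal: "max_ideal m \<Longrightarrow> losing m"
  unfolding losing_def losing_at_def by blast

lemma losing_two_or_four:
  assumes m: "max_ideal m" and J: "is_ideal J" "J \<subseteq> m"
    and "\<And>x y. x \<in> m \<Longrightarrow> y \<in> m \<Longrightarrow> x * y \<in> J" and "dim m = dim J + 2 \<or> dim m = dim J + 4"
  shows "losing J"
proof -
  have "prod_mod m m J \<subseteq> J"
    using assms by (intro prod_mod_minimal subspace_ideal) auto
  then have "prod_mod m m J = J" using subset_prod_mod by blast
  then have "losing_at m J" unfolding losing_at_def using assms by auto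
  then show ?thesis unfolding losing_def using m by blast
qed

lemma losing_two_two:
  assumes m: "max_ideal m" and "J \<subseteq> m"
    and "\<And>x p. x \<in> m \<Longrightarrow> p \<in> prod_mod m m J \<Longrightarrow> x * p \<in> J"
    and "dim m = dim (prod_mod m m J) + 2" "dim (prod_mod m m J) = dim J + 2"
  shows "losing J"
proof -
  have "losing_at m J" unfolding losing_at_def Let_def using assms by blast
  then show ?thesis unfolding losing_def using m by blast
qed

text \<open>Products of three elements of m lie in \<open>I\<close>, hence in the prime ideal m', so
  m = m'. If \<open>a\<close> is in P = m^2 + I, then \<open>I\<close> has type (1,2,2) and the move
  cuts the last 2 to 1. Otherwise P grows by one dimension, so dim m - dim P becomes 1 or 3, whereas
  a losing ideal needs 0, 2 or 4.\<close>

lemma adjoin_losing_not_losing: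
  assumes I: "is_ideal I" and "losing I" and a: "a \<notin> I"
  shows "\<not> losing (adjoin I a)"
proof
  assume "losing (adjoin I a)"
  define J where "J = adjoin I a"
  obtain m' where m': "max_ideal m'" "losing_at m' J"
    using \<open>losing (adjoin I a)\<close> unfolding losing_def J_def by blast
  obtain m where m: "max_ideal m" "losing_at m I" using \<open>losing I\<close> unfolding losing_def by blast
  have mi: "is_ideal m" "is_ideal m'" using m m' unfolding max_ideal_def by blast+
  have J: "is_ideal J" "I \<subseteq> J" "a \<in> J"
    unfolding J_def using I is_ideal_adjoin subset_adjoin self_in_adjoin by blast+
  have Im: "I \<subseteq> m" and Jm': "J \<subseteq> m'" using m m' unfolding losing_at_def by auto
  have cube: "x * (y * z) \<in> m'" if "x \<in> m" "y \<in> m" "z \<in> m" for x y z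
  proof -
    have "x * (y * z) \<in> I"
      using m(2) prod_mod_mult[OF that(2,3), of I] that is_idealD(3,4)[OF mi(1)]
      unfolding losing_at_def by blast
    then show ?thesis using J(2) Jm' by blast
  qed
  have "m \<subseteq> m'" using cube max_ideal_prime[OF m'(1)] by blast
  then have mm': "m = m'" by (rule max_ideal_eqI[OF m(1) m'(1)])
  have am: "a \<in> m" using J Jm' mm' by blast
  then have "I \<noteq> m" using a by blast
  define P where "P = prod_mod m m I"
  have cubeI: "x * p \<in> I" if "x \<in> m" "p \<in> P" for x p
    using m(2) \<open>I \<noteq> m\<close> that unfolding losing_at_def P_def by blast
  have P: "is_ideal P" "I \<subseteq> P" unfolding P_def using is_ideal_prod_mod mi I subset_prod_mod by blast+
  have mP: "x * y \<in> P" if "x \<in> m" "y \<in> m" for x y unfolding P_def using that by (rule prod_mod_mult)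
  have Pm: "P \<subseteq> m"
    unfolding P_def using Im mi is_idealD(3) by (intro prod_mod_minimal subspace_ideal) auto
  have dims: "dim m = dim P + 2 \<and> P = I \<or> dim m = dim P + 4 \<and> P = I \<or> dim m = dim P + 2 \<and> dim P = dim I + 2"
    using m(2) \<open>I \<noteq> m\<close> unfolding losing_at_def P_def Let_def by blast
  have J_sub: "J \<subseteq> span (insert a P)"
    unfolding J_def using am P mP by (intro adjoin_subset_span_insert[OF m(1)] subspace_ideal) auto
  define P' where "P' = prod_mod m m J"
  have P'_sub: "P' \<subseteq> span (insert a P)"
    unfolding P'_def using J_sub mP by (intro prod_mod_minimal) (auto intro: span_base)
  have P': "is_ideal P'" "J \<subseteq> P'" "P \<subseteq> P'"
    unfolding P'_def
    using is_ideal_prod_mod[OF mi(1) J(1)] subset_prod_mod[of J] prod_mod_mono[OF order_refl J(2)]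
    by (simp_all add: P_def)
  have P'_eq: "P' = span (insert a P)"
    using P'_sub span_insert_subset[of P' P a] P' J subspace_ideal by blast
  have lJ: "J = m \<or> J \<subseteq> m \<and> (dim m = dim P' + 2 \<and> P' = J \<or> dim m = dim P' + 4 \<and> P' = J \<or>
      dim m = dim P' + 2 \<and> dim P' = dim J + 2)"
    using m'(2) unfolding losing_at_def P'_def mm' Let_def by blast
  show False
  proof (cases "a \<in> P")
    case True
    then have PP': "P' = P" using P'_eq P subspace_ideal by (simp add: insert_absorb)
    have "J = span (insert a I)"
      unfolding J_def using cubeI True by (intro adjoin_eq_span_insert[OF m(1) I])
    then have "dim J = dim I + 1" using dim_span_insert subspace_ideal I a by simp
    moreover have "P \<noteq> I" using True a by blast
    ultimately show False using dims lJ PP' by auto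
  next
    case False
    then have "dim P' = dim P + 1" using dim_span_insert subspace_ideal P P'_eq by simp
    moreover have "P' = m" if "J = m" 
      using that P' P'_sub Pm am span_insert_subset[of m P a] subspace_ideal mi by blast
    ultimately show False using dims lJ by auto
  qed
qed

text \<open>Suppose that multiplication by every a in m outside \<open>P\<close>, as a map from m to
  the plane P/I, has rank 1. The products span the plane, so there are two of them, y x and v u, on
  different lines. Each of u x, v x and u y lies on both lines, hence in \<open>I\<close>. Then x +
  u maps y and v to y x and v u modulo \<open>I\<close>, so it has rank 2.\<close>

lemma bilinear_rank_dichotomy:
  assumes m: "is_ideal m" and I: "is_ideal I" "I \<subseteq> m"
    and P_def: "P = prod_mod m m I"
    and cube: "\<And>x p. x \<in> m \<Longrightarrow> p \<in> P \<Longrightarrow> x * p \<in> I"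
    and "P \<noteq> m" "P \<subseteq> m" and dimP: "dim P = dim I + 2"
  shows "\<exists>a\<in>m - P. (\<forall>x\<in>m. x * a \<in> I) \<or> P \<subseteq> prod_mod m {a} I"
proof (rule ccontr)
  assume neg: "\<not> ?thesis"
  have neg': "\<not> ((\<forall>x\<in>m. x * a \<in> I) \<or> P \<subseteq> prod_mod m {a} I)" if "a \<in> m - P" for a
    using neg by (rule contrapos_nn) (rule bexI[OF _ that])
  have no_kernel: "\<exists>y\<in>m. y * a \<notin> I" if "a \<in> m - P" for a
    using neg'[OF that] by (rule contrapos_np) blast
  have no_full: "\<not> P \<subseteq> prod_mod m {a} I" if "a \<in> m - P" for a
    using neg'[OF that] by (rule contrapos_nn) (rule disjI2)
  \<comment> \<open>The line of x modulo \<open>I\<close>, which degenerates to \<open>I\<close>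
    itself when x is in \<open>I\<close>.\<close>
  define A where "A x = span (insert x I)" for x
  have sI: "subspace I" and sP: "subspace P"
    using I m subspace_ideal is_ideal_prod_mod unfolding P_def by blast+
  have mP: "x * y \<in> P" if "x \<in> m" "y \<in> m" for x y unfolding P_def using that by (rule prod_mod_mult)
  have IP: "I \<subseteq> P" unfolding P_def by (rule subset_prod_mod)
  have A_iff: "x \<in> A y \<longleftrightarrow> (\<exists>c. x - scale c y \<in> I)" for x y
    unfolding A_def using span_insert_subspace[OF sI] .
  have rank_one: "w * a \<in> A (v * a)" if "a \<in> m" "v \<in> m" "w \<in> m" "v * a \<notin> I" for a v w
  proof -
    have "a \<notin> P" using cube that by blast
    define T where "T = prod_mod m {a} I"
    have sT: "subspace T" unfolding T_def by (intro subspace_ideal is_ideal_prod_mod m I)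
    have IT: "I \<subseteq> T" unfolding T_def by (rule subset_prod_mod)
    have aT: "x * a \<in> T" if "x \<in> m" for x unfolding T_def using that by (intro prod_mod_mult) auto
    have TP: "T \<subseteq> P" unfolding P_def T_def using \<open>a \<in> m\<close> by (intro prod_mod_mono) auto
    have "T \<subset> P" using no_full[of a] \<open>a \<in> m\<close> \<open>a \<notin> P\<close> TP unfolding T_def by blast
    then have "dim T < dim I + 2" using dim_subspace_less[OF sT sP] dimP by simp
    moreover have "dim (A (v * a)) = dim I + 1" unfolding A_def using dim_span_insert[OF sI that(4)] .
    moreover have "A (v * a) \<subseteq> T" unfolding A_def using span_insert_subset[OF sT IT aT[OF that(2)]] .
    ultimately have "A (v * a) = T" using sT by (intro subspace_dim_equal) (auto simp: A_def)
    then show ?thesis using aT that by blast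
  qed
  have A_Int: "z \<in> I" if "z \<in> A x" "z \<in> A y" "y \<notin> A x" for x y z
  proof -
    obtain c d where cd: "z - scale c x \<in> I" "z - scale d y \<in> I" using \<open>z \<in> A x\<close> \<open>z \<in> A y\<close> A_iff by blast
    have "d = 0"
    proof (rule ccontr)
      assume "d \<noteq> 0"
      have "scale (inverse d) ((z - scale c x) - (z - scale d y)) \<in> I"
        using is_idealD(6)[OF I(1)] is_ideal_scale[OF I(1)] cd by blast
      also have "scale (inverse d) ((z - scale c x) - (z - scale d y)) = y - scale (inverse d * c) x"
        using \<open>d \<noteq> 0\<close> by (simp add: scale_right_diff_distrib)
      finally show False using \<open>y \<notin> A x\<close> A_iff by blast
    qed
    then show ?thesis using cd by simp
  qed
  obtain x where x: "x \<in> m" "x \<notin> P" using \<open>P \<noteq> m\<close> \<open>P \<subseteq> m\<close> by blast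
  then obtain y where y: "y \<in> m" "y * x \<notin> I" using no_kernel by blast
  \<comment> \<open>One line cannot contain all products, because they span P/I.\<close>
  have "\<not> P \<subseteq> A (y * x)"
  proof
    assume "P \<subseteq> A (y * x)"
    then have "dim P \<le> dim (A (y * x))" by (rule dim_subset)
    then show False using dim_span_insert[OF sI y(2)] dimP unfolding A_def by simp
  qed
  moreover have "P \<subseteq> A (y * x)" if "\<And>u v. u \<in> m \<Longrightarrow> v \<in> m \<Longrightarrow> u * v \<in> A (y * x)"
    unfolding P_def using that unfolding A_def
    by (intro prod_mod_minimal) (auto intro: span_base)
  ultimately obtain u v where uv: "u \<in> m" "v \<in> m" "v * u \<notin> A (y * x)" by blast
  have IA: "z \<in> A w" if "z \<in> I" for z w unfolding A_def using that by (intro span_base) blast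
  then have uvI: "v * u \<notin> I" using uv by blast
  have vuI: "u * v \<notin> I" using uvI by (subst mult.commute)
  have "u * x \<in> A (v * u)"
    using rank_one[OF uv(1,2) x(1) uvI] by (simp only: mult.commute[of u x])
  then have "u * x \<in> I" by (rule A_Int[OF rank_one[OF x(1) y(1) uv(1) y(2)] _ uv(3)])
  have "v * x \<in> A (v * u)"
    using rank_one[OF uv(2,1) x(1) vuI] by (simp only: mult.commute[of v x] mult.commute[of v u])
  then have "v * x \<in> I" by (rule A_Int[OF rank_one[OF x(1) y(1) uv(2) y(2)] _ uv(3)])
  have xyI: "x * y \<notin> I" using y(2) by (subst mult.commute)
  have "u * y \<in> A (y * x)"
    using rank_one[OF y(1) x(1) uv(1) xyI] by (simp only: mult.commute[of y x])
  moreover have "u * y \<in> A (v * u)"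
    using rank_one[OF uv(1,2) y(1) uvI] by (simp only: mult.commute[of u y])
  ultimately have "u * y \<in> I" by (rule A_Int[OF _ _ uv(3)])
  \<comment> \<open>Rank one for x + u makes v (x + u) a multiple of y (x + u) modulo
    \<open>I\<close>. Cancelling v x and u y then puts v u on the line of y x.\<close>
  have "y * (x + u) - u * y = y * x" by (simp add: algebra_simps)
  then have yxu: "y * (x + u) \<notin> I" using \<open>u * y \<in> I\<close> y(2) is_idealD(6)[OF I(1)] by metis
  have "v * (x + u) \<in> A (y * (x + u))"
    using rank_one[OF _ y(1) uv(2) yxu] is_idealD(2)[OF m] x uv by blast
  then obtain c where c: "v * (x + u) - scale c (y * (x + u)) \<in> I" using A_iff by blast
  have "v * (x + u) - scale c (y * (x + u)) - v * x + scale c (u * y) \<in> I"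
    by (rule is_idealD(2)[OF I(1) is_idealD(6)[OF I(1) c \<open>v * x \<in> I\<close>] is_ideal_scale[OF I(1) \<open>u * y \<in> I\<close>]])
  also have "v * (x + u) - scale c (y * (x + u)) - v * x + scale c (u * y) = v * u - scale c (y * x)"
    by (simp add: algebra_simps)
  finally show False using uv(3) A_iff by blast
qed

text \<open>The variables stand for the dimensions of \<open>I\<close>, m^3 + I, m^2 + I and m; 5
  bounds dim m in an algebra of rank at most 6. The last disjunct is (1,2,2), either alone or
  followed by a degree three part of dimension one.\<close>

lemma hilbert_function_cases:
  fixes i p3 p m :: nat
  assumes "i \<le> p3" "p3 < p" "p < m" "m \<le> 5"
  shows "m = p + 1 \<or> p = p3 + 1 \<and> (m = p + 2 \<or> m = p + 4) \<or> p = p3 + 1 \<and> m = p + 3 \<or>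
    m = p + 3 \<and> p = p3 + 2 \<and> p3 = i \<or> m = p + 2 \<and> p = p3 + 3 \<and> p3 = i \<or>
    m = p + 2 \<and> p = p3 + 2 \<and> (p3 = i \<or> p3 = i + 1)"
proof -
  obtain a where a: "p3 = i + a" using assms(1) le_Suc_ex by blast
  obtain b where b: "p = p3 + Suc b" using assms(2) less_iff_Suc_add by auto
  obtain c where c: "m = p + Suc c" using assms(3) less_iff_Suc_add by auto
  \<comment> \<open>The two strict inequalities use up two of the five dimensions.\<close>
  have "i + a + b + c \<le> 3" using assms(4) a b c by simp
  then have "c = 0 \<or> c = 1 \<and> (b = 0 \<or> b = 1 \<and> (a = 0 \<or> a = 1) \<or> b = 2 \<and> a = 0) \<or>
      c = 2 \<and> (b = 0 \<or> b = 1 \<and> a = 0) \<or> c = 3 \<and> b = 0"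
    by arith
  then show ?thesis unfolding c b a by (elim disjE conjE) simp_all
qed

text \<open>The hypothesis on powers says that R/I is local, which is what Nakayama's lemma
  requires. It makes the filtration by m, m^2 + I, m^3 + I drop strictly until \<open>I\<close> is
  reached, and the sizes of the drops decide the move.\<close>

lemma local_win:
  assumes m: "max_ideal m" and I: "is_ideal I" and Im: "I \<subseteq> m"
    and nil: "\<And>t. t \<in> m \<Longrightarrow> \<exists>k. t ^ k \<in> I"
    and dimension: "dimension \<le> 6" and "\<not> losing I"
  shows "\<exists>a. a \<notin> I \<and> losing (adjoin I a)"
proof -
  have mi: "is_ideal m" using m unfolding max_ideal_def by blast
  define P where "P = prod_mod m m I"
  define P3 where "P3 = prod_mod m P I"
  have Pi: "is_ideal P" and P3i: "is_ideal P3"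
    unfolding P_def P3_def using is_ideal_prod_mod mi I by blast+
  have sI: "subspace I" and sm: "subspace m" and sP: "subspace P" and sP3: "subspace P3"
    using subspace_ideal I mi Pi P3i by blast+
  have mm: "x * y \<in> P" if "x \<in> m" "y \<in> m" for x y unfolding P_def using that by (rule prod_mod_mult)
  have mP: "x * y \<in> P3" if "x \<in> m" "y \<in> P" for x y unfolding P3_def using that by (rule prod_mod_mult)
  have Pm: "P \<subseteq> m" unfolding P_def using Im is_idealD(3)[OF mi] by (intro prod_mod_minimal sm) auto
  have IP3: "I \<subseteq> P3" unfolding P3_def by (rule subset_prod_mod)
  have P3P: "P3 \<subseteq> P" unfolding P3_def P_def using Pm by (intro prod_mod_mono) (auto simp: P_def)
  have "I \<noteq> m" using losing_max_ideal[OF m] \<open>\<not> losing I\<close> by blast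
  have nak: "A = B" if "is_ideal A" "is_ideal B" "I \<subseteq> B" "B \<subseteq> A" "A \<subseteq> prod_mod m A B" for A B
    using nakayama[OF that(1,2,4) _ that(5)] nil that(3) by blast
  have "P \<noteq> m" using nak[OF mi I] Im \<open>I \<noteq> m\<close> unfolding P_def by blast
  have dPm: "dim P < dim m" using dim_subspace_less[OF sP sm] \<open>P \<noteq> m\<close> Pm by blast
  have "m \<noteq> UNIV" using m unfolding max_ideal_def by blast
  then have "dim m < dim (UNIV :: 'r set)" by (intro dim_subspace_less sm) auto
  then have dm: "dim m \<le> 5" using dimension by (simp add: dimension_def)
  have dIP3: "dim I \<le> dim P3" and dP3P: "dim P3 \<le> dim P" using dim_subset IP3 P3P by blast+
  have full: "B = span (insert a A)" if "subspace A" "subspace B" "A \<subseteq> B" "a \<in> B - A" "dim B = dim A + 1" for A B a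
    using that dim_span_insert[of A a] span_insert_subset[of B A a]
    by (intro subspace_dim_equal[symmetric]) auto
  consider (principal) "dim m = dim P + 1" | (square_zero) "P = I" "dim m \<noteq> dim P + 1"
    | (two_or_four) "dim P = dim P3 + 1" "dim m = dim P + 2 \<or> dim m = dim P + 4"
    | (three) "dim P = dim P3 + 1" "dim m = dim P + 3"
    | (three_two) "dim m = dim P + 3" "dim P = dim P3 + 2" "P3 = I"
    | (two_three) "dim m = dim P + 2" "dim P = dim P3 + 3" "P3 = I"
    | (two_two) "dim m = dim P + 2" "dim P = dim P3 + 2" "P3 = I"
    | (two_two_one) "dim m = dim P + 2" "dim P = dim P3 + 2" "dim P3 = dim I + 1"
  proof -
    have "P3 \<noteq> P" if "P \<noteq> I" using nak[OF Pi I] IP3 P3P that unfolding P3_def by blast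
    then have "P = I \<or> dim P3 < dim P" using dim_subspace_less[OF sP3 sP] P3P by blast
    moreover have "P3 = I" if "dim P3 = dim I" using subspace_dim_equal[OF sI sP3 IP3] that by simp
    moreover note hilbert_function_cases[OF dIP3 _ dPm dm]
    ultimately show thesis using that by metis
  qed
  then show ?thesis
  proof cases
    case principal
    \<comment> \<open>Embedding dimension one: a generates m modulo m^2, hence m itself modulo
      \<open>I\<close>, and the quotient becomes K.\<close>
    obtain a where a: "a \<in> m" "a \<notin> P" using \<open>P \<noteq> m\<close> Pm by blast
    define J where "J = adjoin I a"
    have J: "is_ideal J" "I \<subseteq> J" "a \<in> J" "J \<subseteq> m"
      unfolding J_def using is_ideal_adjoin[OF I, of a] subset_adjoin[of I a] self_in_adjoin[OF I, of a]
        adjoin_minimal[OF mi Im a(1)] by auto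
    have "m = span (insert a P)" using full[OF sP sm Pm] a principal by blast
    also have "\<dots> \<subseteq> prod_mod m m J"
      using prod_mod_mono[of m m I J m] subset_prod_mod[of J m m] J is_ideal_prod_mod[OF mi J(1), of m]
      unfolding P_def by (intro span_insert_subset subspace_ideal) auto
    finally have "m = J" using nak[OF mi J(1,2,4)] by blast
    then have "losing J" using losing_max_ideal m by blast
    moreover have "a \<notin> I" using a IP3 P3P by blast
    ultimately show ?thesis unfolding J_def by blast
  next
    case square_zero
    \<comment> \<open>The type is (1,d) with d different from 1, 2 and 4. So d is 3 or 5, and any
      move inside m lowers it to 2 or 4.\<close>
    obtain a where a: "a \<in> m" "a \<notin> I" using \<open>I \<noteq> m\<close> Im by blast
    have mI: "x * y \<in> I" if "x \<in> m" "y \<in> m" for x y using mm[OF that] square_zero by simp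
    have J: "adjoin I a = span (insert a I)" using mI a by (intro adjoin_eq_span_insert[OF m I])
    then have "dim (adjoin I a) = dim I + 1" using dim_span_insert[OF sI a(2)] by simp
    moreover have "dim m \<noteq> dim I + 2" "dim m \<noteq> dim I + 4"
      using losing_two_or_four[OF m I Im mI] \<open>\<not> losing I\<close> by blast+
    ultimately have "dim m = dim (adjoin I a) + 2 \<or> dim m = dim (adjoin I a) + 4"
      using square_zero dPm dm by auto
    then have "losing (adjoin I a)"
      using mI subset_adjoin[of I a] adjoin_minimal[OF mi Im a(1)] is_ideal_adjoin[OF I]
      by (intro losing_two_or_four[OF m]) auto
    then show ?thesis using a by blast
  next
    case two_or_four
    \<comment> \<open>One dimension separates m^2 from m^3, so a single element generates P modulo
      \<open>I\<close>, and R/P has type (1,2) or (1,4).\<close>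
    then have "P \<noteq> P3" by auto
    then obtain a where a: "a \<in> P" "a \<notin> P3" using P3P by blast
    define J where "J = adjoin I a"
    have J: "is_ideal J" "I \<subseteq> J" "a \<in> J" "J \<subseteq> P"
      unfolding J_def using is_ideal_adjoin[OF I, of a] subset_adjoin[of I a] self_in_adjoin[OF I, of a]
        adjoin_minimal[OF Pi order_trans[OF IP3 P3P] a(1)] by auto
    have "P = span (insert a P3)" using full[OF sP3 sP P3P] a two_or_four by blast
    also have "\<dots> \<subseteq> prod_mod m P J"
      using prod_mod_mono[of P P I J m] subset_prod_mod[of J m P] J is_ideal_prod_mod[OF mi J(1), of P]
      unfolding P3_def by (intro span_insert_subset subspace_ideal) auto
    finally have "P = J" using nak[OF Pi J(1,2,4)] by blast
    moreover have "losing P" using losing_two_or_four[OF m Pi Pm mm two_or_four(2)] .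
    moreover have "a \<notin> I" using a IP3 by blast
    ultimately show ?thesis unfolding J_def by blast
  next
    case three
    \<comment> \<open>Some product y x spans P modulo P3, and Nakayama upgrades this to P = mx + I.
      So adjoining x swallows m^2 and leaves type (1,2).\<close>
    have "\<not> P \<subseteq> P3"
      using three dim_subset[of P P3] by auto
    then obtain x y where xy: "x \<in> m" "y \<in> m" "y * x \<notin> P3"
      using prod_mod_minimal[OF sP3 IP3, of m m] unfolding P_def by blast
    define Q where "Q = prod_mod m {x} I"
    have Q: "is_ideal Q" "I \<subseteq> Q" "y * x \<in> Q" "Q \<subseteq> P"
      unfolding Q_def P_def using is_ideal_prod_mod[OF mi I] subset_prod_mod[of I m "{x}"] xy
        prod_mod_mono[of "{x}" m I I m] by (auto intro: prod_mod_mult)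
    have "P = span (insert (y * x) P3)" using full[OF sP3 sP P3P] xy mm three by blast
    also have "\<dots> \<subseteq> prod_mod m P Q"
      using prod_mod_mono[of P P I Q m] subset_prod_mod[of Q m P] Q is_ideal_prod_mod[OF mi Q(1), of P]
      unfolding P3_def by (intro span_insert_subset subspace_ideal) auto
    finally have PQ: "P = Q" using nak[OF Pi Q(1,2,4)] by blast
    define J where "J = adjoin I x"
    have J: "is_ideal J" "I \<subseteq> J" "x \<in> J" "J \<subseteq> m"
      unfolding J_def using is_ideal_adjoin[OF I, of x] subset_adjoin[of I x] self_in_adjoin[OF I, of x]
        adjoin_minimal[OF mi Im xy(1)] by auto
    have PJ: "P \<subseteq> J"
      unfolding PQ Q_def using J is_idealD(3)[OF J(1)] by (intro prod_mod_minimal subspace_ideal) auto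
    have "x \<notin> P" using mP[OF xy(2)] xy(3) by blast
    have "J \<subseteq> span (insert x P)"
      unfolding J_def using IP3 P3P mm xy by (intro adjoin_subset_span_insert[OF m sP]) auto
    moreover have "span (insert x P) \<subseteq> J" using PJ J subspace_ideal by (intro span_insert_subset) auto
    ultimately have "dim J = dim P + 1" using dim_span_insert[OF sP \<open>x \<notin> P\<close>] by simp
    then have "losing J" using PJ mm three J by (intro losing_two_or_four[OF m]) auto
    then show ?thesis using \<open>x \<notin> P\<close> IP3 P3P unfolding J_def by blast
  next
    case three_two
    have cube: "x * p \<in> I" if "x \<in> m" "p \<in> P" for x p using mP[OF that] three_two by simp
    \<comment> \<open>Rank 2 puts P into the new ideal and leaves (1,2). Rank 0 adds only the line
      of a and leaves (1,2,2).\<close>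
    obtain a where a: "a \<in> m - P" and alt: "(\<forall>x\<in>m. x * a \<in> I) \<or> P \<subseteq> prod_mod m {a} I"
      using bilinear_rank_dichotomy[OF mi I Im P_def cube \<open>P \<noteq> m\<close> Pm] three_two by metis
    define J where "J = adjoin I a"
    have J: "is_ideal J" "I \<subseteq> J" "a \<in> J" "J \<subseteq> m"
      unfolding J_def using is_ideal_adjoin[OF I, of a] subset_adjoin[of I a] self_in_adjoin[OF I, of a]
        adjoin_minimal[OF mi Im, of a] a by auto
    have dP: "dim (span (insert a P)) = dim P + 1" using dim_span_insert[OF sP] a by simp
    have JP: "J \<subseteq> span (insert a P)"
      unfolding J_def using IP3 P3P mm a by (intro adjoin_subset_span_insert[OF m sP]) auto
    have "losing J"
      using alt
    proof
      assume "P \<subseteq> prod_mod m {a} I"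
      also have "\<dots> \<subseteq> J"
        using J is_idealD(3)[OF J(1)] by (intro prod_mod_minimal subspace_ideal) auto
      finally have PJ: "P \<subseteq> J" .
      then have "J = span (insert a P)" using JP span_insert_subset[of J P a] J subspace_ideal by blast
      then show ?thesis using PJ mm three_two J dP by (intro losing_two_or_four[OF m]) auto
    next
      assume aI: "\<forall>x\<in>m. x * a \<in> I"
      then have Ja: "J = span (insert a I)" unfolding J_def by (intro adjoin_eq_span_insert[OF m I]) auto
      have dJ: "dim J = dim I + 1" using dim_span_insert[OF sI, of a] a IP3 P3P unfolding Ja by auto
      have "prod_mod m m J \<subseteq> span (insert a P)"
        using JP mm by (intro prod_mod_minimal) (auto intro: span_base)
      moreover have "span (insert a P) \<subseteq> prod_mod m m J"
        using prod_mod_mono[of m m I J m] subset_prod_mod[of J m m] J is_ideal_prod_mod[OF mi J(1), of m]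
        unfolding P_def by (intro span_insert_subset subspace_ideal) auto
      ultimately have PJ: "prod_mod m m J = span (insert a P)" by blast
      have "x * p \<in> J" if x: "x \<in> m" and p: "p \<in> prod_mod m m J" for x p
      proof -
        obtain c where c: "p - scale c a \<in> P" using p span_insert_subspace[OF sP] unfolding PJ by blast
        have "x * (p - scale c a) + scale c (x * a) \<in> I"
          using is_idealD(2)[OF I cube[OF x c] is_ideal_scale[OF I]] aI x by blast
        moreover have "x * (p - scale c a) + scale c (x * a) = x * p"
          by (simp add: right_diff_distrib mult_scale_right)
        ultimately show ?thesis using J(2) by auto
      qed
      then show ?thesis using three_two dP dJ J by (intro losing_two_two[OF m]) (auto simp: PJ)
    qed
    then show ?thesis using a IP3 P3P unfolding J_def by blast
  next
    case two_three
    \<comment> \<open>Since mP lies in \<open>I\<close>, any element of P outside \<open>I\<close>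
      removes exactly one dimension from the degree two part and leaves (1,2,2).\<close>
    then have "P \<noteq> P3" by auto
    then obtain a where a: "a \<in> P" "a \<notin> I" using P3P two_three by blast
    define J where "J = adjoin I a"
    have J: "is_ideal J" "I \<subseteq> J" "a \<in> J" "J \<subseteq> P"
      unfolding J_def using is_ideal_adjoin[OF I, of a] subset_adjoin[of I a] self_in_adjoin[OF I, of a]
        adjoin_minimal[OF Pi order_trans[OF IP3 P3P] a(1)] by auto
    have cube: "x * p \<in> I" if "x \<in> m" "p \<in> P" for x p using mP[OF that] two_three by simp
    have "J = span (insert a I)" unfolding J_def using cube a by (intro adjoin_eq_span_insert[OF m I]) auto
    then have "dim J = dim I + 1" using dim_span_insert[OF sI a(2)] by simp
    note dJ = this
    have PJ: "prod_mod m m J = P" unfolding P_def using J by (intro prod_mod_absorb) (auto simp: P_def)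
    have "losing J"
    proof (rule losing_two_two[OF m])
      show "J \<subseteq> m" using J Pm by blast
      show "x * p \<in> J" if "x \<in> m" "p \<in> prod_mod m m J" for x p
        using cube[of x p] that J(2) unfolding PJ by blast
    qed (use two_three dJ in \<open>simp_all add: PJ\<close>)
    then show ?thesis using a unfolding J_def by blast
  next
    case two_two
    have cube: "x * p \<in> I" if "x \<in> m" "p \<in> P" for x p using mP[OF that] two_two by simp
    have "losing I" using cube Im two_two by (intro losing_two_two[OF m]) (auto simp: P_def[symmetric])
    then show ?thesis using \<open>\<not> losing I\<close> by blast
  next
    case two_two_one
    \<comment> \<open>m^3 + I exceeds \<open>I\<close> by one dimension, so one element yields it,
      and the quotient by it has type (1,2,2).\<close>
    then have "P3 \<noteq> I" by auto
    then obtain a where a: "a \<in> P3" "a \<notin> I" using IP3 by blast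
    have "adjoin I a \<subseteq> P3" using adjoin_minimal[OF P3i IP3 a(1)] .
    moreover have "P3 = span (insert a I)" using full[OF sI sP3 IP3] a two_two_one by blast
    moreover have "span (insert a I) \<subseteq> adjoin I a"
      by (intro span_insert_subset subspace_ideal is_ideal_adjoin subset_adjoin self_in_adjoin I)
    ultimately have J: "adjoin I a = P3" by blast
    have PJ: "prod_mod m m P3 = P"
      unfolding P_def using IP3 P3P by (intro prod_mod_absorb) (auto simp: P_def)
    have "losing P3"
    proof (rule losing_two_two[OF m])
      show "P3 \<subseteq> m" using P3P Pm by blast
      show "x * p \<in> P3" if "x \<in> m" "p \<in> prod_mod m m P3" for x p
        using mP that unfolding PJ by blast
    qed (use two_two_one in \<open>simp_all add: PJ\<close>)
    then show ?thesis using a J by metis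
  qed
qed

end

section \<open>Residue fields over an algebraically closed field, and quotients that are not
  local\<close>

locale alg_closed_comm_algebra = fin_comm_algebra scale Basis
  for scale :: "'k::alg_closed_field \<Rightarrow> 'r::comm_ring_1 \<Rightarrow> 'r" and Basis
begin

definition eval_poly :: "'k poly \<Rightarrow> 'r \<Rightarrow> 'r" where
  "eval_poly p r = poly (map_poly (\<lambda>c. scale c 1) p) r"

lemma eval_poly_0 [simp]: "eval_poly 0 r = 0"
  by (simp add: eval_poly_def)

lemma eval_poly_pCons [simp]: "eval_poly (pCons a p) r = scale a 1 + r * eval_poly p r"
  by (simp add: eval_poly_def map_poly_pCons)

lemma eval_poly_add: "eval_poly (p + q) r = eval_poly p r + eval_poly q r"
  by (induction p q rule: poly_induct2) (simp_all add: algebra_simps scale_left_distrib)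

lemma eval_poly_smult: "eval_poly (smult c p) r = scale c (eval_poly p r)"
  by (induction p) (simp_all add: algebra_simps mult_scale_right)

lemma eval_poly_diff: "eval_poly (p - q) r = eval_poly p r - eval_poly q r"
  using eval_poly_add[of "p - q" q r] by simp

lemma eval_poly_monom: "eval_poly (monom 1 i) r = r ^ i"
  by (induction i) (simp_all add: monom_0 monom_Suc)

text \<open>Otherwise the powers of \<open>r\<close> would be linearly independent, more of them
  than the dimension allows.\<close>

lemma ex_eval_poly_eq_0: "\<exists>p. p \<noteq> 0 \<and> eval_poly p r = 0"
proof (rule ccontr)
  assume no: "\<not> ?thesis"
  have notin: "r ^ i \<notin> span ((^) r ` {..<i})" for i
  proof
    assume "r ^ i \<in> span ((^) r ` {..<i})"
    \<comment> \<open>The values of polynomials of degree below i, stated by coefficients so that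
      the zero polynomial is included for i = 0 as well.\<close>
    moreover have "span ((^) r ` {..<i}) \<subseteq> {eval_poly q r | q. \<forall>j\<ge>i. coeff q j = 0}" (is "_ \<subseteq> ?W")
    proof (rule span_minimal)
      have "r ^ j \<in> ?W" if "j < i" for j
        using that by (intro CollectI exI[of _ "monom 1 j"]) (auto simp: eval_poly_monom)
      then show "(^) r ` {..<i} \<subseteq> ?W" by blast
      show "subspace ?W"
        unfolding subspace_def
      proof (intro conjI ballI allI)
        show "0 \<in> ?W" by (intro CollectI exI[of _ 0]) simp
        fix x assume "x \<in> ?W"
        then obtain q where q: "x = eval_poly q r" "\<forall>j\<ge>i. coeff q j = 0" by blast
        show "scale c x \<in> ?W" for c
          using q by (intro CollectI exI[of _ "smult c q"]) (simp add: eval_poly_smult)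
        fix y assume "y \<in> ?W"
        then obtain q' where "y = eval_poly q' r" "\<forall>j\<ge>i. coeff q' j = 0" by blast
        then show "x + y \<in> ?W"
          using q by (intro CollectI exI[of _ "q + q'"]) (simp add: eval_poly_add)
      qed
    qed
    ultimately obtain q where q: "r ^ i = eval_poly q r" "\<forall>j\<ge>i. coeff q j = 0" by blast
    have "coeff (monom 1 i - q) i = 1" using q by simp
    then have "monom 1 i - q \<noteq> 0" by (metis coeff_0 zero_neq_one)
    moreover have "eval_poly (monom 1 i - q) r = 0" using q by (simp add: eval_poly_diff eval_poly_monom)
    ultimately show False using no by blast
  qed
  have "dim ((^) r ` {..<i}) = i" for i
    by (induction i) (simp_all add: lessThan_Suc dim_insert notin)
  from this[of "Suc dimension"] show False using dim_subset_UNIV by (metis Suc_n_not_le_n)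
qed

text \<open>Let m be maximal among the proper ideals above \<open>I\<close>. Take a nonzero
  polynomial p of least degree with p(r) in m, and a root c of it, so p = (X - c) q. By minimality
  q(r) is outside m, hence invertible modulo m, and so p(r) in m puts r - c in m.\<close>

lemma ex_max_ideal:
  assumes I: "is_ideal I" and "1 \<notin> I"
  obtains m where "max_ideal m" "I \<subseteq> m"
proof -
  have "I \<subseteq> I \<and> 1 \<notin> I" using assms by blast
  then obtain m where m: "is_ideal m" "I \<subseteq> m \<and> 1 \<notin> m"
    and m_max: "\<And>J. is_ideal J \<Longrightarrow> I \<subseteq> J \<and> 1 \<notin> J \<Longrightarrow> dim J \<le> dim m"
    using is_ideal_chain_max[where Pr = "\<lambda>J. I \<subseteq> J \<and> 1 \<notin> J", OF I] by metis
  have "\<exists>c. r - scale c 1 \<in> m" for r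
  proof -
    define Q where "Q p \<longleftrightarrow> p \<noteq> 0 \<and> eval_poly p r \<in> m" for p
    have "\<exists>p. Q p" unfolding Q_def using ex_eval_poly_eq_0[of r] is_idealD(1)[OF m(1)] by metis
    then obtain p where p: "Q p" "\<And>q. Q q \<Longrightarrow> degree p \<le> degree q"
      using ex_has_least_nat[of Q _ degree] by blast
    have "degree p \<noteq> 0"
    proof
      assume "degree p = 0"
      then obtain a where a: "p = [:a:]" by (rule degree_eq_zeroE)
      then have a': "scale a 1 \<in> m" "a \<noteq> 0" using p(1) unfolding Q_def by auto
      show False using is_ideal_scale[OF m(1) a'(1), of "inverse a"] a'(2) m(2) by simp
    qed
    then obtain c where "poly p c = 0" using alg_closed_imp_poly_has_root[of p] by blast
    then obtain q where q: "p = [:- c, 1:] * q" using poly_eq_0_iff_dvd by blast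
    have pq: "eval_poly p r = (r - scale c 1) * eval_poly q r"
      unfolding q by (simp add: eval_poly_diff eval_poly_smult algebra_simps scale_mult_left)
    have "q \<noteq> 0" using q p(1) unfolding Q_def by auto
    have "degree p = Suc (degree q)" unfolding q using \<open>q \<noteq> 0\<close> by (subst degree_mult_eq) auto
    then have "\<not> Q q" using p(2)[of q] by auto
    then have qm: "eval_poly q r \<notin> m" unfolding Q_def using \<open>q \<noteq> 0\<close> by blast
    have "1 \<in> adjoin m (eval_poly q r)"
      using m_max[OF is_ideal_adjoin[OF m(1)]] dim_adjoin_less[OF m(1) qm] m(2) subset_adjoin by fastforce
    then obtain u s where us: "1 = u + s * eval_poly q r" "u \<in> m" unfolding adjoin_def by blast
    have "r - scale c 1 = (r - scale c 1) * (u + s * eval_poly q r)" using us by simp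
    also have "\<dots> = (r - scale c 1) * u + s * eval_poly p r" unfolding pq by (simp add: algebra_simps)
    also have "\<dots> \<in> m" using is_idealD(2,3)[OF m(1)] us p(1) unfolding Q_def by blast
    finally show ?thesis by blast
  qed
  then have "max_ideal m" unfolding max_ideal_def using m by blast
  then show thesis using that m by blast
qed

text \<open>Induction on the codimension. If R/I is not local, some t in a maximal ideal m has no
  power in \<open>I\<close>. The idempotent built from t lies in m but not in \<open>I\<close>, so I
  + (e) is proper and strictly larger than \<open>I\<close>.\<close>

lemma not_losing_ex_move:
  assumes I: "is_ideal I" and "\<not> losing I" and "I \<noteq> UNIV" and dimension: "dimension \<le> 6"
  shows "\<exists>a. a \<notin> I \<and> losing (adjoin I a)"
  using assms(1-3)
proof (induction "dimension - dim I" arbitrary: I rule: less_induct)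
  case less
  note I = \<open>is_ideal I\<close>
  obtain m where m: "max_ideal m" "I \<subseteq> m" using ex_max_ideal[OF I] is_ideal_eq_UNIV[OF I] less.prems by blast
  then have mi: "is_ideal m" "1 \<notin> m" unfolding max_ideal_def by blast+
  show ?case
  proof (cases "\<forall>t\<in>m. \<exists>k. t ^ k \<in> I")
    case True
    then show ?thesis using local_win[OF m(1) I m(2) _ dimension] less.prems by blast
  next
    case False
    then obtain t where t: "t \<in> m" "\<And>k. t ^ k \<notin> I" by blast
    obtain k s where k: "k > 0" "t ^ k - t ^ k * (s * t ^ k) \<in> I"
      "(s * t ^ k) * (s * t ^ k) - s * t ^ k \<in> I" using idempotent_mod[OF I] .
    define e where "e = s * t ^ k"
    have "t ^ k \<in> m" using t(1) is_idealD(4)[OF mi(1)] k(1) by (cases k) auto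
    then have em: "e \<in> m" unfolding e_def using is_idealD(3)[OF mi(1)] by blast
    have eI: "e \<notin> I"
    proof
      assume "e \<in> I"
      then have "(t ^ k - t ^ k * e) + t ^ k * e \<in> I"
        using k(2) is_idealD(2,3)[OF I] unfolding e_def by blast
      then show False using t(2)[of k] by simp
    qed
    define N where "N = adjoin I e"
    have N: "is_ideal N" "I \<subseteq> N" "e \<in> N" "N \<subseteq> m"
      unfolding N_def
      using is_ideal_adjoin[OF I] subset_adjoin[of I e] self_in_adjoin[OF I] adjoin_minimal[OF mi(1) m(2) em]
      by auto
    show ?thesis
    proof (cases "losing N")
      case True
      then show ?thesis using eI unfolding N_def by blast
    next
      case False
      have "dim I < dim N" unfolding N_def by (rule dim_adjoin_less[OF I eI])
      then have "dimension - dim N < dimension - dim I" using dim_ideal_le[OF N(1)] by simp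
      then obtain a where a: "a \<notin> N" "losing (adjoin N a)"
        using less.hyps[OF _ N(1) False] N mi by blast
      define b where "b = e + (1 - e) * a"
      define J where "J = adjoin I b"
      have J: "is_ideal J" "I \<subseteq> J" "b \<in> J"
        unfolding J_def using is_ideal_adjoin[OF I] subset_adjoin[of I b] self_in_adjoin[OF I] by auto
      \<comment> \<open>Since e is idempotent modulo \<open>I\<close>, the product e b is congruent
        to e. So b recovers e, and from it a.\<close>
      have "e * b + (e * e - e) * (a - 1) \<in> J"
        using J k(3) is_idealD(2,3,4)[OF J(1)] unfolding e_def by blast
      moreover have "e * b + (e * e - e) * (a - 1) = e" unfolding b_def by (simp add: algebra_simps)
      ultimately have eJ: "e \<in> J" by simp
      have "b - e + e * a \<in> J" using J eJ is_idealD(2,4,6)[OF J(1)] by blast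
      then have aJ: "a \<in> J" unfolding b_def by (simp add: algebra_simps)
      have Na: "is_ideal (adjoin N a)" "N \<subseteq> adjoin N a" "a \<in> adjoin N a"
        using is_ideal_adjoin[OF N(1)] subset_adjoin[of N a] self_in_adjoin[OF N(1)] by auto
      then have "b \<in> adjoin N a" unfolding b_def using N is_idealD(2,3)[OF Na(1)] by blast
      then have "J \<subseteq> adjoin N a" unfolding J_def using N Na by (intro adjoin_minimal) auto
      moreover have "N \<subseteq> J" unfolding N_def using J eJ by (intro adjoin_minimal) auto
      then have "adjoin N a \<subseteq> J" using aJ by (intro adjoin_minimal J)
      ultimately have "losing J" using a by (simp add: subset_antisym)
      moreover have "b \<notin> I"
      proof
        assume "b \<in> I"
        then have "J \<subseteq> I" unfolding J_def by (intro adjoin_minimal I) auto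
        then show False using eJ eI by blast
      qed
      ultimately show ?thesis unfolding J_def by blast
    qed
  qed
qed

theorem alice_wins_iff_not_losing:
  assumes "dimension \<le> 6"
  shows "alice_wins TYPE('r) \<longleftrightarrow> \<not> losing {0}"
proof -
  have "alice_wins TYPE('r) \<longleftrightarrow> {0} \<notin> Collect losing"
    using dim_adjoin_less dim_subset_UNIV not_losing_UNIV adjoin_losing_not_losing
      not_losing_ex_move[OF _ _ _ assms]
    by (intro alice_wins_iff[where d = dim and N = dimension]) auto
  then show ?thesis by simp
qed

end

section \<open>Monomial ideals\<close>

text \<open>For \<open>D\<close> closed under divisors this is the monomial ideal whose standard
  monomials are \<open>D\<close>; the coefficients in \<open>D\<close> are then the normal form in
  the quotient.\<close>

definition coeffs_vanish :: "('v \<Rightarrow>\<^sub>0 nat) set \<Rightarrow> ('v, 'k::field) mpolys set" where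
  "coeffs_vanish D = {p. \<forall>s\<in>D. Poly_Mapping.lookup p s = 0}"

definition down_closed :: "('v \<Rightarrow>\<^sub>0 nat) set \<Rightarrow> bool" where
  "down_closed D \<longleftrightarrow> (\<forall>s t. s + t \<in> D \<longrightarrow> s \<in> D)"

lemma down_closedD: "down_closed D \<Longrightarrow> s + t \<in> D \<Longrightarrow> s \<in> D" "down_closed D \<Longrightarrow> s + t \<in> D \<Longrightarrow> t \<in> D"
  unfolding down_closed_def by (metis, metis add.commute)

text \<open>Both parts of any splitting of \<open>u\<close> stay in \<open>D\<close>. So modulo
  \<open>coeffs_vanish D\<close> a product depends only on coefficients in \<open>D\<close>, and
  infinite formal sums become finite.\<close>

lemma lookup_mult_down_closed:
  fixes p q :: "('v, 'k::field) mpolys"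
  assumes D: "finite D" "down_closed D" and u: "u \<in> D"
  shows "Poly_Mapping.lookup (p * q) u =
    (\<Sum>s\<in>D. \<Sum>t\<in>D. Poly_Mapping.lookup p s * Poly_Mapping.lookup q t when u = s + t)"
proof -
  have inner: "Sum_any (\<lambda>t. Poly_Mapping.lookup q t when u = s + t) =
      (\<Sum>t\<in>D. Poly_Mapping.lookup q t when u = s + t)" for s
  proof (intro Sum_any.expand_superset D subsetI)
    fix t assume "t \<in> {t. (Poly_Mapping.lookup q t when u = s + t) \<noteq> 0}"
    then have "u = s + t" by (simp add: when_def split: if_splits)
    then show "t \<in> D" using down_closedD(2)[OF D(2), of s t] u by simp
  qed
  have "Poly_Mapping.lookup (p * q) u =
      Sum_any (\<lambda>s. Poly_Mapping.lookup p s * (\<Sum>t\<in>D. Poly_Mapping.lookup q t when u = s + t))"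
    by (simp only: lookup_mult inner)
  also have "\<dots> = (\<Sum>s\<in>D. Poly_Mapping.lookup p s * (\<Sum>t\<in>D. Poly_Mapping.lookup q t when u = s + t))"
  proof (intro Sum_any.expand_superset D subsetI)
    fix s assume "s \<in> {s. Poly_Mapping.lookup p s * (\<Sum>t\<in>D. Poly_Mapping.lookup q t when u = s + t) \<noteq> 0}"
    then have "(\<Sum>t\<in>D. Poly_Mapping.lookup q t when u = s + t) \<noteq> 0" by auto
    then obtain t where "(Poly_Mapping.lookup q t when u = s + t) \<noteq> 0"
      by (rule sum.not_neutral_contains_not_neutral)
    then have "u = s + t" by (simp add: when_def split: if_splits)
    then show "s \<in> D" using down_closedD(1)[OF D(2), of s t] u by simp
  qed
  finally show ?thesis by (simp add: sum_distrib_left mult_when)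
qed

lemma poly_mapping_sum_single:
  "p = (\<Sum>s\<in>Poly_Mapping.keys p. Poly_Mapping.single s (Poly_Mapping.lookup p s))"
  by (rule poly_mapping_eqI)
    (auto simp: lookup_sum lookup_single when_def in_keys_iff sum.delta[OF finite_keys])

lemma lookup_mscale: "Poly_Mapping.lookup (mscale c p) s = c * Poly_Mapping.lookup p s"
  unfolding mscale_def
proof (subst lookup_mult)
  let ?S = "Sum_any (\<lambda>t. Poly_Mapping.lookup p t when s = t)"
  have "Poly_Mapping.lookup (Poly_Mapping.single 0 c) l * Sum_any (\<lambda>t. Poly_Mapping.lookup p t when s = l + t) =
     (c * ?S when l = 0)" for l
    by (auto simp: lookup_single when_def)
  then show "Sum_any (\<lambda>l. Poly_Mapping.lookup (Poly_Mapping.single 0 c) l *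
      Sum_any (\<lambda>t. Poly_Mapping.lookup p t when s = l + t)) = c * Poly_Mapping.lookup p s"
    by simp
qed

lemma is_ideal_coeffs_vanish:
  assumes D: "finite D" "down_closed D" shows "is_ideal (coeffs_vanish D :: ('v, 'k::field) mpolys set)"
  unfolding is_ideal_def coeffs_vanish_def
  by (auto simp: lookup_add lookup_mult_down_closed[OF D])

lemma is_ideal_ideal_gen: "is_ideal (ideal_gen S)"
  unfolding is_ideal_subspace ideal_gen_def by (rule module.subspace_span[OF module_mult])

lemma ideal_gen_superset: "S \<subseteq> ideal_gen S"
  unfolding ideal_gen_def by (rule module.span_superset[OF module_mult])

lemma ideal_gen_minimal: "S \<subseteq> I \<Longrightarrow> is_ideal I \<Longrightarrow> ideal_gen S \<subseteq> I"
  unfolding ideal_gen_def is_ideal_subspace by (rule module.span_minimal[OF module_mult])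

lemma is_ideal_sum: "is_ideal I \<Longrightarrow> (\<And>x. x \<in> A \<Longrightarrow> f x \<in> I) \<Longrightarrow> sum f A \<in> I"
  by (induction A rule: infinite_finite_induct) (auto simp: is_idealD)

lemma coeffs_vanish_subset:
  fixes I :: "('v, 'k::field) mpolys set"
  assumes I: "is_ideal I" and "\<And>s c. s \<notin> D \<Longrightarrow> Poly_Mapping.single s c \<in> I"
  shows "coeffs_vanish D \<subseteq> I"
proof
  fix p :: "('v, 'k) mpolys" assume "p \<in> coeffs_vanish D"
  then show "p \<in> I"
    by (subst poly_mapping_sum_single)
      (auto intro!: is_ideal_sum[OF I] assms(2) simp: coeffs_vanish_def in_keys_iff)
qed

text \<open>A polynomial is the sum of its terms, and a term with exponent outside \<open>D\<close>
  is a multiple of a generator.\<close>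

lemma ideal_gen_monomials:
  assumes D: "finite D" "down_closed D" and GD: "G \<inter> D = {}"
    and div: "\<And>s. s \<notin> D \<Longrightarrow> \<exists>g\<in>G. \<exists>u. s = u + g"
  shows "ideal_gen ((\<lambda>g. Poly_Mapping.single g 1) ` G) = (coeffs_vanish D :: ('v, 'k::field) mpolys set)"
proof
  show "ideal_gen ((\<lambda>g. Poly_Mapping.single g 1) ` G) \<subseteq> (coeffs_vanish D :: ('v, 'k) mpolys set)"
    using GD by (intro ideal_gen_minimal is_ideal_coeffs_vanish D)
      (auto simp: coeffs_vanish_def lookup_single when_def)
  show "(coeffs_vanish D :: ('v, 'k) mpolys set) \<subseteq> ideal_gen ((\<lambda>g. Poly_Mapping.single g 1) ` G)" (is "_ \<subseteq> ?I")
  proof (rule coeffs_vanish_subset[OF is_ideal_ideal_gen])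
    fix s :: "'v \<Rightarrow>\<^sub>0 nat" and c :: 'k assume "s \<notin> D"
    then obtain g u where g: "g \<in> G" "s = u + g" using div by blast
    have "Poly_Mapping.single s c = Poly_Mapping.single u c * Poly_Mapping.single g 1"
      using g(2) by (simp add: mult_single)
    moreover have "Poly_Mapping.single g 1 \<in> ?I" by (rule subsetD[OF ideal_gen_superset imageI[OF g(1)]])
    then have "Poly_Mapping.single u c * Poly_Mapping.single g 1 \<in> ?I"
      by (rule is_idealD(3)[OF is_ideal_ideal_gen])
    ultimately show "Poly_Mapping.single s c \<in> ?I" by (simp only:)
  qed
qed

section \<open>Exponents of degree at most one and the square of the ideal of all variables\<close>

lemma exponent_split:
  fixes s g :: "'v \<Rightarrow>\<^sub>0 nat"
  assumes "\<And>v. Poly_Mapping.lookup g v \<le> Poly_Mapping.lookup s v"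
  shows "s = (s - g) + g"
  using assms by (intro poly_mapping_eqI) (simp add: lookup_add lookup_minus)

text \<open>The standard monomials of the square of the ideal of all variables. Keeping the variable
  type general treats two and four variables at once.\<close>

definition linear_exponents :: "('v::finite \<Rightarrow>\<^sub>0 nat) set" where
  "linear_exponents = insert 0 (range (\<lambda>v. Poly_Mapping.single v 1))"

lemma single_one_split:
  fixes s :: "'v \<Rightarrow>\<^sub>0 nat"
  assumes "s \<noteq> 0" obtains u v where "s = u + Poly_Mapping.single v 1"
proof -
  obtain v where "Poly_Mapping.lookup s v \<noteq> 0"
    using assms by (metis lookup_zero poly_mapping_eqI)
  then have "s = (s - Poly_Mapping.single v 1) + Poly_Mapping.single v 1"
    by (intro exponent_split) (auto simp: lookup_single when_def)
  then show thesis using that by blast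
qed

lemma single_one_indecomposable:
  fixes s t :: "'v \<Rightarrow>\<^sub>0 nat"
  assumes "Poly_Mapping.single v 1 = s + t" shows "s = 0 \<or> t = 0"
proof (rule ccontr)
  assume "\<not> ?thesis"
  then obtain u a w b where "s = u + Poly_Mapping.single a 1" "t = w + Poly_Mapping.single b 1"
    using single_one_split by metis
  then have eq: "Poly_Mapping.lookup (Poly_Mapping.single v 1) x =
      Poly_Mapping.lookup u x + (1 when a = x) + (Poly_Mapping.lookup w x + (1 when b = x))" for x
    using assms by (simp add: lookup_add lookup_single)
  \<comment> \<open>At a and at b the right side is positive, which forces a = b = v; but then it is
    at least 2 there.\<close>
  show False using eq[of a] eq[of b] by (auto simp: lookup_single when_def split: if_splits)
qed

lemma down_closed_zero: "down_closed {0}"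
proof -
  have "Poly_Mapping.lookup s k = 0" if "s + t = 0" for s t :: "'v \<Rightarrow>\<^sub>0 nat" and k
    using arg_cong[OF that, of "\<lambda>p. Poly_Mapping.lookup p k"] by (simp add: lookup_add)
  then have "s = 0" if "s + t = 0" for s t :: "'v \<Rightarrow>\<^sub>0 nat"
    using that by (intro poly_mapping_eqI) simp
  then show ?thesis unfolding down_closed_def by blast
qed

lemma single_one_neq_0: "Poly_Mapping.single v (1::nat) \<noteq> 0"
  by (metis lookup_single_eq lookup_zero zero_neq_one)

lemma down_closed_linear_exponents: "down_closed (linear_exponents :: ('v::finite \<Rightarrow>\<^sub>0 nat) set)"
  unfolding down_closed_def
proof (intro allI impI)
  fix s t :: "'v \<Rightarrow>\<^sub>0 nat" assume "s + t \<in> linear_exponents"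
  then consider "s + t = 0" | v where "Poly_Mapping.single v 1 = s + t"
    unfolding linear_exponents_def by force
  then show "s \<in> linear_exponents"
  proof cases
    case 1
    then have "s = 0" using down_closed_zero unfolding down_closed_def by auto
    then show ?thesis unfolding linear_exponents_def by simp
  next
    case (2 v)
    then show ?thesis using single_one_indecomposable[OF 2] unfolding linear_exponents_def
      by (metis add_0_right insertCI rangeI)
  qed
qed

lemma finite_linear_exponents: "finite linear_exponents"
  unfolding linear_exponents_def by simp

lemma zero_in_linear_exponents: "0 \<in> linear_exponents"
  unfolding linear_exponents_def by simp

lemma single_one_eq_iff: "Poly_Mapping.single v (1::nat) = Poly_Mapping.single w 1 \<longleftrightarrow> v = w"
  by (metis lookup_single_eq lookup_single_not_eq zero_neq_one)

lemma card_linear_exponents: "card (linear_exponents :: ('v::finite \<Rightarrow>\<^sub>0 nat) set) = CARD('v) + 1"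
proof -
  have "inj (\<lambda>v::'v. Poly_Mapping.single v (1::nat))" by (rule injI) (simp only: single_one_eq_iff)
  then have "card (range (\<lambda>v::'v. Poly_Mapping.single v (1::nat))) = CARD('v)" by (rule card_image)
  moreover have "0 \<notin> range (\<lambda>v::'v. Poly_Mapping.single v (1::nat))" using single_one_neq_0 by (metis rangeE)
  ultimately show ?thesis unfolding linear_exponents_def by (subst card_insert_disjoint) auto
qed

lemma add_notin_linear_exponents:
  assumes "s \<noteq> 0" "t \<noteq> 0" shows "s + t \<notin> linear_exponents"
proof
  assume "s + t \<in> linear_exponents"
  then consider "s + t = 0" | x where "Poly_Mapping.single x 1 = s + t"
    unfolding linear_exponents_def by force
  then show False
  proof cases
    case 1
    then show False using down_closedD(1)[OF down_closed_zero, of s t] assms by simp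
  next
    case (2 x)
    then show False using single_one_indecomposable[OF 2] assms by simp
  qed
qed

lemma ideal_gen_mvar: "ideal_gen (range mvar) = (coeffs_vanish {0} :: ('v, 'k::field) mpolys set)"
proof -
  have gens: "range (mvar :: 'v \<Rightarrow> ('v, 'k) mpolys) =
      (\<lambda>g. Poly_Mapping.single g 1) ` range (\<lambda>v. Poly_Mapping.single v 1)"
    unfolding mvar_def by auto
  show ?thesis
    unfolding gens
  proof (rule ideal_gen_monomials)
    show "\<exists>g\<in>range (\<lambda>v. Poly_Mapping.single v 1). \<exists>u. s = u + g" if "s \<notin> {0}" for s :: "'v \<Rightarrow>\<^sub>0 nat"
      using that single_one_split[of s] by (metis rangeI singletonI)
    show "range (\<lambda>v::'v. Poly_Mapping.single v (1::nat)) \<inter> {0} = {}"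
      using single_one_neq_0 unfolding disjoint_iff by (metis rangeE singletonD)
  qed (simp_all add: down_closed_zero)
qed

text \<open>A coefficient of degree at most one in a product always involves the constant term of a
  factor, which is zero. Conversely, two variables split off from any monomial of degree at least
  two.\<close>

lemma ideal_prod_mvar:
  "ideal_prod (ideal_gen (range mvar)) (ideal_gen (range mvar)) =
    (coeffs_vanish linear_exponents :: ('v::finite, 'k::field) mpolys set)" (is "ideal_prod ?m ?m = ?V")
proof
  have "a * b \<in> ?V" if "a \<in> ?m" "b \<in> ?m" for a b
  proof -
    have z: "Poly_Mapping.lookup a 0 = 0" "Poly_Mapping.lookup b 0 = 0"
      using that unfolding ideal_gen_mvar coeffs_vanish_def by auto
    have "Poly_Mapping.lookup (a * b) u = 0" if u: "u \<in> linear_exponents" for u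
    proof -
      have st: "s = 0 \<or> t = 0" if "u = s + t" for s t
      proof (cases "u = 0")
        case True
        then show ?thesis using down_closedD(1)[OF down_closed_zero, of s t] that by simp
      next
        case False
        then obtain v where "u = Poly_Mapping.single v 1" using u unfolding linear_exponents_def by auto
        then show ?thesis using single_one_indecomposable[of v s t] that by simp
      qed
      have "(Poly_Mapping.lookup a s * Poly_Mapping.lookup b t when u = s + t) = 0" for s t
        using st[of s t] z by (auto simp: when_def)
      then show ?thesis
        unfolding lookup_mult_down_closed[OF finite_linear_exponents down_closed_linear_exponents u]
        by simp
    qed
    then show ?thesis unfolding coeffs_vanish_def by blast
  qed
  then show "ideal_prod ?m ?m \<subseteq> ?V"
    unfolding ideal_prod_def
    by (intro ideal_gen_minimal is_ideal_coeffs_vanish finite_linear_exponents down_closed_linear_exponents) auto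
  show "?V \<subseteq> ideal_prod ?m ?m"
  proof (rule coeffs_vanish_subset)
    show "is_ideal (ideal_prod ?m ?m)" unfolding ideal_prod_def by (rule is_ideal_ideal_gen)
    fix s :: "'v \<Rightarrow>\<^sub>0 nat" and c :: 'k assume s: "s \<notin> linear_exponents"
    then have "s \<noteq> 0" unfolding linear_exponents_def by auto
    then obtain u v where u: "s = u + Poly_Mapping.single v 1" by (rule single_one_split)
    then have "u \<noteq> 0" using s unfolding linear_exponents_def by auto
    then obtain w x where w: "u = w + Poly_Mapping.single x 1" by (rule single_one_split)
    have "Poly_Mapping.single s c = (Poly_Mapping.single w c * mvar x) * mvar v"
      unfolding u w mvar_def by (simp add: mult_single)
    moreover have mv: "mvar y \<in> ?m" for y :: 'v by (rule subsetD[OF ideal_gen_superset rangeI])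
    moreover have "Poly_Mapping.single w c * mvar x \<in> ?m"
      by (rule is_idealD(3)[OF is_ideal_ideal_gen mv])
    ultimately have "Poly_Mapping.single s c \<in> {u * v |u v. u \<in> ?m \<and> v \<in> ?m}"
      by (intro CollectI exI conjI)
    then show "Poly_Mapping.single s c \<in> ideal_prod ?m ?m"
      unfolding ideal_prod_def by (rule subsetD[OF ideal_gen_superset])
  qed
qed

section \<open>The four explicit ideals and their standard monomials\<close>

lemma UNIV_2: "(UNIV :: 2 set) = {0, 1}"
  by (rule card_subset_eq[symmetric]) auto

lemma UNIV_4: "(UNIV :: 4 set) = {0, 1, 2, 3}"
  by (rule card_subset_eq[symmetric]) auto

lemma ideal_xy_squared_eq:
  "ideal_xy_squared = (coeffs_vanish linear_exponents :: (2, 'k::field) mpolys set)"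
proof -
  have "{mvar 0, mvar 1} = range (mvar :: 2 \<Rightarrow> (2, 'k) mpolys)" by (simp add: UNIV_2)
  then show ?thesis unfolding ideal_xy_squared_def Let_def by (simp only: ideal_prod_mvar)
qed

lemma ideal_xyzw_squared_eq:
  "ideal_xyzw_squared = (coeffs_vanish linear_exponents :: (4, 'k::field) mpolys set)"
proof -
  have "{mvar 0, mvar 1, mvar 2, mvar 3} = range (mvar :: 4 \<Rightarrow> (4, 'k) mpolys)" by (simp add: UNIV_4)
  then show ?thesis unfolding ideal_xyzw_squared_def Let_def by (simp only: ideal_prod_mvar)
qed

definition expo :: "nat \<Rightarrow> nat \<Rightarrow> (2 \<Rightarrow>\<^sub>0 nat)" where
  "expo i j = Poly_Mapping.single 0 i + Poly_Mapping.single 1 j"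

lemma lookup_expo [simp]: "Poly_Mapping.lookup (expo i j) 0 = i" "Poly_Mapping.lookup (expo i j) 1 = j"
  by (simp_all add: expo_def lookup_add lookup_single)

lemma expo_eq_iff [simp]: "expo i j = expo k l \<longleftrightarrow> i = k \<and> j = l"
  by (metis lookup_expo)

lemma expo_add [simp]: "expo i j + expo k l = expo (i + k) (j + l)"
  by (simp add: expo_def single_add algebra_simps)

lemma expo_0: "expo 0 0 = 0"
  by (simp add: expo_def)

lemma expo_cases: obtains i j where "s = expo i j"
proof -
  have "\<forall>v. Poly_Mapping.lookup s v =
      Poly_Mapping.lookup (expo (Poly_Mapping.lookup s 0) (Poly_Mapping.lookup s 1)) v"
    using UNIV_2 by (metis UNIV_I insertE lookup_expo singletonD)
  then show thesis using that poly_mapping_eqI by blast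
qed

text \<open>Standard monomials of (xy, x^3, y^3), named after the quadratic relation xy = 0.\<close>

definition xy_exponents :: "(2 \<Rightarrow>\<^sub>0 nat) set" where
  "xy_exponents = {expo 0 0, expo 1 0, expo 0 1, expo 2 0, expo 0 2}"

text \<open>Standard monomials of (x^2, xy^2, y^3), named after the quadratic relation x^2 =
  0.\<close>

definition xx_exponents :: "(2 \<Rightarrow>\<^sub>0 nat) set" where
  "xx_exponents = {expo 0 0, expo 1 0, expo 0 1, expo 1 1, expo 0 2}"

lemma down_closed_expoI:
  assumes "\<And>i j k l. expo (i + k) (j + l) \<in> D \<Longrightarrow> expo i j \<in> D" shows "down_closed D"
  unfolding down_closed_def using assms by (metis expo_add expo_cases)

lemma down_closed_xy_exponents: "down_closed xy_exponents"
  by (rule down_closed_expoI) (simp add: xy_exponents_def, arith)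

lemma down_closed_xx_exponents: "down_closed xx_exponents"
  by (rule down_closed_expoI) (simp add: xx_exponents_def, arith)

lemma mvar_powers: "(mvar 0 :: (2, 'k::field) mpolys) ^ i * mvar 1 ^ j = Poly_Mapping.single (expo i j) 1"
proof -
  have "(mvar v :: (2, 'k) mpolys) ^ i = Poly_Mapping.single (Poly_Mapping.single v i) 1" for v i
    by (induction i) (simp_all add: mvar_def mult_single flip: single_add)
  then show ?thesis by (simp add: mult_single expo_def)
qed

text \<open>Serves twice: to identify the ideal, and to show that in a concrete algebra all
  monomials outside the list vanish once the three generators do.\<close>

lemma xy_exponents_compl:
  assumes s: "s \<notin> xy_exponents"
  shows "\<exists>g\<in>{expo 1 1, expo 3 0, expo 0 3}. \<exists>u. s = u + g"
proof -
  obtain i j where ij: "s = expo i j" by (rule expo_cases)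
  consider "i \<ge> 1" "j \<ge> 1" | "i \<ge> 3" | "j \<ge> 3"
    using s unfolding ij xy_exponents_def by simp arith
  then show ?thesis
  proof cases
    case 1
    then have "s = expo (i - 1) (j - 1) + expo 1 1" unfolding ij by simp
    then show ?thesis by blast
  next
    case 2
    then have "s = expo (i - 3) j + expo 3 0" unfolding ij by simp
    then show ?thesis by blast
  next
    case 3
    then have "s = expo i (j - 3) + expo 0 3" unfolding ij by simp
    then show ?thesis by blast
  qed
qed

lemma finite_xy_exponents: "finite xy_exponents"
  by (simp add: xy_exponents_def)

lemma card_xy_exponents: "card xy_exponents = 5"
  by (simp add: xy_exponents_def)

lemma zero_in_xy_exponents: "0 \<in> xy_exponents"
  by (simp add: xy_exponents_def expo_0)

lemma ideal_xy_x3_y3_eq: "ideal_xy_x3_y3 = (coeffs_vanish xy_exponents :: (2, 'k::field) mpolys set)"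
proof -
  have gens: "{mvar 0 * mvar 1, mvar 0 ^ 3, mvar 1 ^ 3 :: (2, 'k) mpolys} =
      (\<lambda>g. Poly_Mapping.single g 1) ` {expo 1 1, expo 3 0, expo 0 3}"
    using mvar_powers[where 'k = 'k, of 1 1] mvar_powers[where 'k = 'k, of 3 0] mvar_powers[where 'k = 'k, of 0 3] by simp
  show ?thesis
    unfolding ideal_xy_x3_y3_def Let_def gens
  proof (rule ideal_gen_monomials)
    show "\<exists>g\<in>{expo 1 1, expo 3 0, expo 0 3}. \<exists>u. s = u + g" if "s \<notin> xy_exponents" for s
      using xy_exponents_compl[OF that] .
  qed (auto simp: down_closed_xy_exponents, auto simp: xy_exponents_def)
qed

lemma xx_exponents_compl:
  assumes s: "s \<notin> xx_exponents"
  shows "\<exists>g\<in>{expo 2 0, expo 1 2, expo 0 3}. \<exists>u. s = u + g"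
proof -
  obtain i j where ij: "s = expo i j" by (rule expo_cases)
  consider "i \<ge> 2" | "i \<ge> 1" "j \<ge> 2" | "j \<ge> 3"
    using s unfolding ij xx_exponents_def by simp arith
  then show ?thesis
  proof cases
    case 1
    then have "s = expo (i - 2) j + expo 2 0" unfolding ij by simp
    then show ?thesis by blast
  next
    case 2
    then have "s = expo (i - 1) (j - 2) + expo 1 2" unfolding ij by simp
    then show ?thesis by blast
  next
    case 3
    then have "s = expo i (j - 3) + expo 0 3" unfolding ij by simp
    then show ?thesis by blast
  qed
qed

lemma finite_xx_exponents: "finite xx_exponents"
  by (simp add: xx_exponents_def)

lemma card_xx_exponents: "card xx_exponents = 5"
  by (simp add: xx_exponents_def)

lemma zero_in_xx_exponents: "0 \<in> xx_exponents"
  by (simp add: xx_exponents_def expo_0)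

lemma ideal_x2_xy2_y3_eq: "ideal_x2_xy2_y3 = (coeffs_vanish xx_exponents :: (2, 'k::field) mpolys set)"
proof -
  have gens: "{mvar 0 ^ 2, mvar 0 * mvar 1 ^ 2, mvar 1 ^ 3 :: (2, 'k) mpolys} =
      (\<lambda>g. Poly_Mapping.single g 1) ` {expo 2 0, expo 1 2, expo 0 3}"
    using mvar_powers[where 'k = 'k, of 2 0] mvar_powers[where 'k = 'k, of 1 2] mvar_powers[where 'k = 'k, of 0 3] by simp
  show ?thesis
    unfolding ideal_x2_xy2_y3_def Let_def gens
  proof (rule ideal_gen_monomials)
    show "\<exists>g\<in>{expo 2 0, expo 1 2, expo 0 3}. \<exists>u. s = u + g" if "s \<notin> xx_exponents" for s
      using xx_exponents_compl[OF that] .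
  qed (auto simp: down_closed_xx_exponents, auto simp: xx_exponents_def)
qed

section \<open>Monomial bases\<close>

lemma coset_eq_iff: "is_ideal I \<Longrightarrow> coset I p = coset I q \<longleftrightarrow> p - q \<in> I"
proof
  assume I: "is_ideal I" and "coset I p = coset I q"
  then have "p + 0 \<in> coset I q" using is_idealD(1)[OF I] unfolding coset_def by blast
  then show "p - q \<in> I" unfolding coset_def by auto
next
  assume I: "is_ideal I" and pq: "p - q \<in> I"
  have "coset I a \<subseteq> coset I b" if "a - b \<in> I" for a b
  proof
    fix x assume "x \<in> coset I a"
    then obtain u where "x = a + u" "u \<in> I" unfolding coset_def by blast
    then have "x = b + ((a - b) + u)" "(a - b) + u \<in> I" using is_idealD(2)[OF I that] by auto
    then show "x \<in> coset I b" unfolding coset_def by blast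
  qed
  from this[OF pq] this[of q p] is_idealD(5)[OF I pq] show "coset I p = coset I q" by auto
qed

context fin_comm_algebra
begin

text \<open>An isomorphism with the quotient by \<open>coeffs_vanish D\<close>, written as a
  multiplication table inside R: linear independence, spanning, unit, products. Coordinates are
  functions on \<open>D\<close>, which matches coefficient functions of polynomials.\<close>

definition monomial_basis :: "('v \<Rightarrow>\<^sub>0 nat) set \<Rightarrow> (('v \<Rightarrow>\<^sub>0 nat) \<Rightarrow> 'r) \<Rightarrow> bool" where
  "monomial_basis D b \<longleftrightarrow>
    (\<forall>c. (\<Sum>s\<in>D. scale (c s) (b s)) = 0 \<longrightarrow> (\<forall>s\<in>D. c s = 0)) \<and>
    (\<forall>r. \<exists>c. r = (\<Sum>s\<in>D. scale (c s) (b s))) \<and> b 0 = 1 \<and>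
    (\<forall>s\<in>D. \<forall>t\<in>D. b s * b t = (if s + t \<in> D then b (s + t) else 0))"

text \<open>The basis consists of the images of the monomials; each coset has exactly one
  representative supported on \<open>D\<close>.\<close>

lemma isomorphic_to_quotient_imp_monomial_basis:
  assumes D: "finite D" "down_closed D"
    and iso: "isomorphic_to_quotient mscale (coeffs_vanish D :: ('v, 'k) mpolys set) scale"
  obtains b where "monomial_basis D b"
proof -
  define V where "V = (coeffs_vanish D :: ('v, 'k) mpolys set)"
  have eq_iff: "coset V p = coset V q \<longleftrightarrow> (\<forall>s\<in>D. Poly_Mapping.lookup p s = Poly_Mapping.lookup q s)" for p q
    unfolding V_def coset_eq_iff[OF is_ideal_coeffs_vanish[OF D]] by (simp add: coeffs_vanish_def lookup_minus)
  obtain \<phi> where \<phi>: "bij_betw \<phi> (range (coset V)) UNIV" "\<phi> (coset V 1) = 1"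
    "\<And>p q. \<phi> (coset V (p + q)) = \<phi> (coset V p) + \<phi> (coset V q)"
    "\<And>p q. \<phi> (coset V (p * q)) = \<phi> (coset V p) * \<phi> (coset V q)"
    "\<And>c p. \<phi> (coset V (mscale c p)) = scale c (\<phi> (coset V p))"
    using iso unfolding isomorphic_to_quotient_def V_def[symmetric] by blast
  define b where "b s = \<phi> (coset V (Poly_Mapping.single s 1))" for s
  have zero: "\<phi> (coset V 0) = 0" using \<phi>(3)[of 0 0] by simp
  have sum: "\<phi> (coset V (\<Sum>s\<in>A. f s)) = (\<Sum>s\<in>A. \<phi> (coset V (f s)))"
    for A :: "('v \<Rightarrow>\<^sub>0 nat) set" and f
    by (induction A rule: infinite_finite_induct) (simp_all add: zero \<phi>(3))
  have single: "\<phi> (coset V (Poly_Mapping.single s c)) = scale c (b s)" for s c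
  proof -
    have "Poly_Mapping.single s c = mscale c (Poly_Mapping.single s 1)"
      by (simp add: mscale_def mult_single)
    then show ?thesis unfolding b_def by (simp only: \<phi>(5))
  qed
  have lookup_sum_D: "Poly_Mapping.lookup (\<Sum>s\<in>D. Poly_Mapping.single s (c s)) t = c t" if "t \<in> D" for c t
    using that D(1) by (simp add: lookup_sum lookup_single when_def)
  have expand: "\<phi> (coset V p) = (\<Sum>s\<in>D. scale (Poly_Mapping.lookup p s) (b s))" for p
  proof -
    have "coset V p = coset V (\<Sum>s\<in>D. Poly_Mapping.single s (Poly_Mapping.lookup p s))"
      unfolding eq_iff by (simp add: lookup_sum_D)
    then show ?thesis by (simp add: sum single)
  qed
  have "c t = 0" if "(\<Sum>s\<in>D. scale (c s) (b s)) = 0" "t \<in> D" for c t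
  proof -
    let ?p = "\<Sum>s\<in>D. Poly_Mapping.single s (c s)"
    have "\<phi> (coset V ?p) = \<phi> (coset V 0)" using that(1) by (simp add: sum single zero)
    then have "coset V ?p = coset V 0" using \<phi>(1) unfolding bij_betw_def by (meson inj_onD rangeI)
    then show "c t = 0" using lookup_sum_D[OF that(2), of c] that(2) unfolding eq_iff by simp
  qed
  moreover have "\<exists>c. r = (\<Sum>s\<in>D. scale (c s) (b s))" for r
  proof -
    obtain p where "r = \<phi> (coset V p)" using \<phi>(1) unfolding bij_betw_def by (metis UNIV_I imageE)
    then show ?thesis using expand by blast
  qed
  moreover have "b 0 = 1" unfolding b_def using \<phi>(2) by simp
  moreover have "b s * b t = (if s + t \<in> D then b (s + t) else 0)" for s t
  proof -
    have "b s * b t = \<phi> (coset V (Poly_Mapping.single (s + t) 1))"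
      unfolding b_def \<phi>(4)[symmetric] by (simp add: mult_single)
    moreover have "coset V (Poly_Mapping.single (s + t) 1) = coset V 0" if "s + t \<notin> D"
      unfolding eq_iff using that by (auto simp: lookup_single when_def)
    ultimately show ?thesis using zero by (simp add: b_def)
  qed
  ultimately show thesis using that[of b] unfolding monomial_basis_def by blast
qed

lemma monomial_basis_imp_isomorphic_to_quotient:
  assumes D: "finite D" "down_closed D" "0 \<in> D" and b: "monomial_basis D b"
  shows "isomorphic_to_quotient mscale (coeffs_vanish D :: ('v, 'k) mpolys set) scale"
proof -
  define V where "V = (coeffs_vanish D :: ('v, 'k) mpolys set)"
  have eq_iff: "coset V p = coset V q \<longleftrightarrow> (\<forall>s\<in>D. Poly_Mapping.lookup p s = Poly_Mapping.lookup q s)" for p q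
    unfolding V_def coset_eq_iff[OF is_ideal_coeffs_vanish[OF D(1,2)]] by (simp add: coeffs_vanish_def lookup_minus)
  define \<psi> where "\<psi> p = (\<Sum>s\<in>D. scale (Poly_Mapping.lookup p s) (b s))" for p
  \<comment> \<open>The choice of representative is harmless: \<open>\<psi>\<close> depends only on
    coefficients in \<open>D\<close>, which the coset determines.\<close>
  define \<phi> where "\<phi> C = \<psi> (SOME p. coset V p = C)" for C
  have \<phi>: "\<phi> (coset V p) = \<psi> p" for p
  proof -
    have "coset V (SOME q. coset V q = coset V p) = coset V p" by (rule someI) simp
    then show ?thesis unfolding \<phi>_def \<psi>_def eq_iff by simp
  qed
  have ind: "c s = 0" if "(\<Sum>s\<in>D. scale (c s) (b s)) = 0" "s \<in> D" for c s
    using b that unfolding monomial_basis_def by blast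
  have add: "\<psi> (p + q) = \<psi> p + \<psi> q" for p q
    unfolding \<psi>_def by (simp add: lookup_add scale_left_distrib sum.distrib)
  have minus: "\<psi> (p - q) = \<psi> p - \<psi> q" for p q
    unfolding \<psi>_def by (simp add: lookup_minus scale_left_diff_distrib sum_subtractf)
  have mult: "\<psi> (p * q) = \<psi> p * \<psi> q" for p q
  proof -
    let ?c = "\<lambda>s t. Poly_Mapping.lookup p s * Poly_Mapping.lookup q t"
    have "\<psi> p * \<psi> q = (\<Sum>s\<in>D. \<Sum>t\<in>D. scale (?c s t) (b s * b t))"
      unfolding \<psi>_def sum_product by (simp add: scale_mult_left mult_scale_right mult.commute)
    \<comment> \<open>The sum over u encodes the case distinction of the table: it has a nonzero
      term only if s + t lies in \<open>D\<close>.\<close>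
    also have "\<dots> = (\<Sum>s\<in>D. \<Sum>t\<in>D. \<Sum>u\<in>D. if u = s + t then scale (?c s t) (b u) else 0)"
      using b D(1) unfolding monomial_basis_def by (intro sum.cong refl) auto
    also have "\<dots> = (\<Sum>s\<in>D. \<Sum>u\<in>D. \<Sum>t\<in>D. if u = s + t then scale (?c s t) (b u) else 0)"
      by (intro sum.cong refl sum.swap)
    also have "\<dots> = (\<Sum>u\<in>D. \<Sum>s\<in>D. \<Sum>t\<in>D. if u = s + t then scale (?c s t) (b u) else 0)"
      by (rule sum.swap)
    also have "\<dots> = \<psi> (p * q)"
      unfolding \<psi>_def
      by (intro sum.cong refl)
        (auto simp: lookup_mult_down_closed[OF D(1,2)] scale_sum_left when_def intro!: sum.cong)
    finally show ?thesis by simp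
  qed
  have "\<psi> 1 = 1"
  proof -
    have "\<psi> 1 = (\<Sum>s\<in>D. if s = 0 then b s else 0)"
      unfolding \<psi>_def by (intro sum.cong refl) (simp add: lookup_one when_def)
    then show ?thesis using D b by (simp add: monomial_basis_def)
  qed
  moreover have "\<psi> (mscale c p) = scale c (\<psi> p)" for c p
    unfolding \<psi>_def by (simp add: lookup_mscale scale_sum_right)
  moreover have "bij_betw \<phi> (range (coset V)) UNIV"
    unfolding bij_betw_def
  proof
    show "inj_on \<phi> (range (coset V))"
    proof (rule inj_onI)
      fix C C' assume "C \<in> range (coset V)" "C' \<in> range (coset V)" and eq: "\<phi> C = \<phi> C'"
      then obtain p q where pq: "C = coset V p" "C' = coset V q" by blast
      have "\<psi> (p - q) = 0" using eq unfolding pq \<phi> by (simp add: minus)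
      then have "\<forall>s\<in>D. Poly_Mapping.lookup (p - q) s = 0"
        using ind[of "Poly_Mapping.lookup (p - q)"] unfolding \<psi>_def by blast
      then show "C = C'" unfolding pq eq_iff by (simp add: lookup_minus)
    qed
    have "r \<in> range (\<lambda>p. \<phi> (coset V p))" for r
    proof -
      obtain c where c: "r = (\<Sum>s\<in>D. scale (c s) (b s))" using b unfolding monomial_basis_def by blast
      have "\<psi> (\<Sum>s\<in>D. Poly_Mapping.single s (c s)) = r"
        unfolding \<psi>_def c using D(1) by (intro sum.cong refl) (simp add: lookup_sum lookup_single when_def)
      then show ?thesis unfolding \<phi> by blast
    qed
    then show "\<phi> ` range (coset V) = UNIV" by (auto simp: image_image)
  qed
  ultimately show ?thesis
    unfolding isomorphic_to_quotient_def V_def[symmetric]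
    by (intro exI[of _ \<phi>]) (simp only: \<phi> add mult simp_thms)
qed

lemma monomial_basis_independent:
  assumes D: "finite D" and b: "monomial_basis D b"
  shows "inj_on b D" "independent (b ` D)" "span (b ` D) = UNIV"
proof -
  have ind: "c s = 0" if "(\<Sum>s\<in>D. scale (c s) (b s)) = 0" "s \<in> D" for c s
    using b that unfolding monomial_basis_def by blast
  show inj: "inj_on b D"
  proof (rule inj_onI, rule ccontr)
    fix s t assume st: "s \<in> D" "t \<in> D" "b s = b t" "s \<noteq> t"
    define c :: "('a \<Rightarrow>\<^sub>0 nat) \<Rightarrow> 'k" where "c = (\<lambda>u. (if u = s then 1 else 0) - (if u = t then 1 else 0))"
    have "scale (c u) (b u) = (if u = s then b u else 0) - (if u = t then b u else 0)" for u
      unfolding c_def by (simp add: scale_left_diff_distrib)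
    then have "(\<Sum>u\<in>D. scale (c u) (b u)) = b s - b t"
      using D st by (simp add: sum_subtractf)
    then have "c s = 0" using ind[of c s] st by simp
    then show False using st unfolding c_def by simp
  qed
  show "independent (b ` D)"
  proof
    assume "dependent (b ` D)"
    then obtain u v where uv: "v \<in> D" "u (b v) \<noteq> 0" "(\<Sum>x\<in>b ` D. scale (u x) x) = 0"
      unfolding dependent_finite[OF finite_imageI[OF D]] by blast
    then show False using ind[of "\<lambda>s. u (b s)" v] sum.reindex[OF inj, of "\<lambda>x. scale (u x) x"] by simp
  qed
  have "r \<in> span (b ` D)" for r
  proof -
    obtain c where "r = (\<Sum>s\<in>D. scale (c s) (b s))" using b unfolding monomial_basis_def by blast
    then show ?thesis by (simp only:) (intro span_sum span_scale span_base imageI)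
  qed
  then show "span (b ` D) = UNIV" by blast
qed

lemma dim_span_monomial_basis:
  assumes D: "finite D" and b: "monomial_basis D b" and "E \<subseteq> D"
  shows "dim (span (b ` E)) = card E"
proof -
  have "independent (b ` E)" using monomial_basis_independent(2)[OF D b] \<open>E \<subseteq> D\<close> by (meson image_mono independent_mono)
  moreover have "inj_on b E" using monomial_basis_independent(1)[OF D b] \<open>E \<subseteq> D\<close> by (rule inj_on_subset)
  ultimately show ?thesis by (simp add: dim_eq_card_independent card_image)
qed

lemma span_mult_mem:
  assumes V: "subspace V" and AB: "\<And>a b. a \<in> A \<Longrightarrow> b \<in> B \<Longrightarrow> a * b \<in> V"
    and "x \<in> span A" "y \<in> span B"
  shows "x * y \<in> V"
proof -
  have 1: "a * y \<in> V" if "a \<in> A" for a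
    using \<open>y \<in> span B\<close>
  proof (induction rule: span_induct)
    case base
    show ?case using V
      unfolding subspace_def by (simp add: distrib_left mult_scale_right)
  qed (use AB that in blast)
  show ?thesis
    using \<open>x \<in> span A\<close>
  proof (induction rule: span_induct)
    case base
    show ?case using V
      unfolding subspace_def by (simp add: distrib_right scale_mult_left)
  qed (rule 1)
qed

text \<open>The nonconstant basis vectors span a maximal ideal m, and m^2 is spanned by those with
  exponent in \<open>E\<close>, the decomposable ones. So the cardinalities give the Hilbert
  function: (1,2), (1,4) and (1,2,2) in the order of \<open>cards\<close>.\<close>

lemma monomial_basis_imp_losing:
  assumes D: "finite D" "0 \<in> D" and b: "monomial_basis D b"
    and E: "E = {u \<in> D. \<exists>s\<in>D - {0}. \<exists>t\<in>D - {0}. u = s + t}"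
    and cube: "\<And>s u. s \<in> D - {0} \<Longrightarrow> u \<in> E \<Longrightarrow> s + u \<notin> D"
    and cards: "card D = 3 \<and> E = {} \<or> card D = 5 \<and> E = {} \<or> card D = 5 \<and> card E = 2"
  shows "losing {0}"
proof -
  define m where "m = span (b ` (D - {0}))"
  have mult: "b s * b t = (if s + t \<in> D then b (s + t) else 0)" if "s \<in> D" "t \<in> D" for s t
    using b that unfolding monomial_basis_def by blast
  have b0: "b 0 = 1" using b unfolding monomial_basis_def by blast
  note ind = monomial_basis_independent[OF D(1) b]
  have "is_ideal m"
    unfolding m_def
  proof (rule is_ideal_span)
    fix r x assume x: "x \<in> b ` (D - {0})"
    have *: "b s * b t \<in> span (b ` (D - {0}))" if "s \<in> D" "t \<in> D - {0}" for s t
    proof -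
      have "s + t \<noteq> 0" using that down_closedD(2)[OF down_closed_zero, of s t] by auto
      then have "b (s + t) \<in> span (b ` (D - {0}))" if "s + t \<in> D"
        using that by (intro span_base imageI) simp
      then show ?thesis using that by (simp add: mult span_zero)
    qed
    show "r * x \<in> span (b ` (D - {0}))"
    proof (rule span_mult_mem[OF subspace_span])
      show "r \<in> span (b ` D)" by (simp add: ind(3))
      show "x \<in> span {x}" by (simp add: span_base)
      show "a * c \<in> span (b ` (D - {0}))" if "a \<in> b ` D" "c \<in> {x}" for a c
        using * x that by blast
    qed
  qed
  moreover have "1 \<notin> m"
  proof -
    have "b ` D - {b 0} = b ` (D - {0})" using inj_on_image_set_diff[OF ind(1), of D "{0}"] D(2) by simp
    then show ?thesis using ind(2) D(2) b0 unfolding dependent_def m_def by (metis imageI)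
  qed
  moreover have "\<exists>c. r - scale c 1 \<in> m" for r
  proof -
    have "r \<in> span (insert (b 0) (b ` (D - {0})))"
      using ind(3) D(2) by (metis UNIV_I image_insert insert_Diff)
    then show ?thesis unfolding span_breakdown_eq b0 m_def .
  qed
  ultimately have m: "max_ideal m" unfolding max_ideal_def by blast
  have "prod_mod m m {0} = span (b ` E)"
  proof
    show "prod_mod m m {0} \<subseteq> span (b ` E)"
    proof (rule prod_mod_minimal)
      fix x y assume xy: "x \<in> m" "y \<in> m"
      have *: "b s * b t \<in> span (b ` E)" if "s \<in> D - {0}" "t \<in> D - {0}" for s t
      proof (cases "s + t \<in> D")
        case True
        then have "s + t \<in> E" unfolding E using that by blast
        then have "b (s + t) \<in> span (b ` E)" by (intro span_base imageI)
        then show ?thesis using that True by (simp add: mult)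
      qed (use that in \<open>auto simp: mult span_zero\<close>)
      show "x * y \<in> span (b ` E)"
        by (rule span_mult_mem[OF subspace_span _ xy[unfolded m_def]]) (use * in blast)
    qed (simp_all add: span_zero)
    have "b u \<in> prod_mod m m {0}" if u: "u \<in> E" for u
    proof -
      obtain s t where st: "s \<in> D - {0}" "t \<in> D - {0}" "u = s + t" "u \<in> D" using u unfolding E by blast
      then have "b u = b s * b t" by (simp add: mult)
      moreover have "b s \<in> m" "b t \<in> m" unfolding m_def using st(1,2) by (simp_all add: span_base)
      ultimately show ?thesis by (simp add: prod_mod_mult)
    qed
    then show "span (b ` E) \<subseteq> prod_mod m m {0}" by (intro span_minimal) (auto simp: prod_mod_def)
  qed
  note P = this
  have "losing_at m {0}"
  proof -
    have "x * p = 0" if "x \<in> m" "p \<in> prod_mod m m {0}" for x p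
    proof -
      have *: "b s * b u = 0" if "s \<in> D - {0}" "u \<in> E" for s u
        using cube[OF that] that E by (simp add: mult)
      have "x * p \<in> {0}"
        by (rule span_mult_mem[OF subspace_single_0 _ that(1)[unfolded m_def] that(2)[unfolded P]]) (use * in blast)
      then show ?thesis by simp
    qed
    moreover have "dim m = card D - 1"
      unfolding m_def using dim_span_monomial_basis[OF D(1) b, of "D - {0}"] D by (simp add: card_Diff_singleton)
    moreover have "dim (span (b ` E)) = card E" using E by (intro dim_span_monomial_basis[OF D(1) b]) auto
    ultimately show ?thesis
      unfolding losing_at_def Let_def P using cards \<open>is_ideal m\<close> is_idealD(1) by auto
  qed
  then show ?thesis unfolding losing_def using m by blast
qed

section \<open>Normal forms of the algebras whose zero ideal is losing\<close>

lemma max_ideal_span: "max_ideal m \<Longrightarrow> span (insert 1 m) = UNIV"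
  using span_insert_subspace[of m _ 1] subspace_ideal unfolding max_ideal_def by blast

lemma dimension_max_ideal: "max_ideal m \<Longrightarrow> dimension = dim m + 1"
  using max_ideal_span[of m] dim_span_insert[of m 1] subspace_ideal[of m]
  unfolding max_ideal_def by (simp add: dimension_def)

text \<open>A spanning family with as many members as the dimension is a basis, so the constructions
  below check only spanning and the multiplication table.\<close>

lemma monomial_basisI:
  assumes D: "finite D" "card D = dimension" and span: "span (b ` D) = UNIV" and "b 0 = 1"
    and "\<And>s t. s \<in> D \<Longrightarrow> t \<in> D \<Longrightarrow> b s * b t = (if s + t \<in> D then b (s + t) else 0)"
  shows "monomial_basis D b"
proof -
  have "dimension \<le> card (b ` D)"
    using dim_le_card[of UNIV "b ` D"] D(1) span by (simp add: dimension_def)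
  then have card: "card (b ` D) = card D" using card_image_le[OF D(1), of b] D(2) by simp
  then have inj: "inj_on b D" by (rule eq_card_imp_inj_on[OF D(1)])
  have indep: "independent (b ` D)"
    by (rule card_le_dim_spanning[of _ UNIV]) (use span card D in \<open>simp_all add: dimension_def\<close>)
  have "c s = 0" if "(\<Sum>s\<in>D. scale (c s) (b s)) = 0" "s \<in> D" for c s
  proof -
    have "(\<Sum>x\<in>b ` D. scale (c (the_inv_into D b x)) x) = 0"
      unfolding sum.reindex[OF inj] o_def using that(1) by (simp add: the_inv_into_f_f[OF inj])
    then have "c (the_inv_into D b (b s)) = 0"
      using independentD[OF indep finite_imageI[OF D(1)] order_refl _ imageI[OF that(2)],
          of "\<lambda>x. c (the_inv_into D b x)"] by simp
    then show ?thesis using the_inv_into_f_f[OF inj that(2)] by simp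
  qed
  moreover have "\<exists>c. r = (\<Sum>s\<in>D. scale (c s) (b s))" for r
  proof -
    have "r \<in> range (\<lambda>u. \<Sum>x\<in>b ` D. scale (u x) x)"
      using span span_finite[OF finite_imageI[OF D(1)]] by blast
    then obtain u where "r = (\<Sum>x\<in>b ` D. scale (u x) x)" by blast
    then have "r = (\<Sum>s\<in>D. scale (u (b s)) (b s))" by (simp add: sum.reindex[OF inj])
    then show ?thesis by (rule exI[of _ "\<lambda>s. u (b s)"])
  qed
  ultimately show ?thesis unfolding monomial_basis_def using assms(4,5) by blast
qed

text \<open>If zero is a maximal ideal with residue field K, every element is a unique scalar
  multiple of 1, and the isomorphism reads off the scalar.\<close>

lemma algebra_isomorphic_field_iff: "algebra_isomorphic scale ((*) :: 'k \<Rightarrow> 'k \<Rightarrow> 'k) \<longleftrightarrow> max_ideal {0}"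
proof
  assume "algebra_isomorphic scale ((*) :: 'k \<Rightarrow> 'k \<Rightarrow> 'k)"
  then obtain \<phi> where \<phi>: "bij \<phi>" "\<phi> 1 = (1::'k)" "\<And>c x. \<phi> (scale c x) = c * \<phi> x"
    unfolding algebra_isomorphic_def by blast
  have "r = scale (\<phi> r) 1" for r
    using \<phi> bij_is_inj[OF \<phi>(1)] by (simp add: inj_eq[symmetric])
  then have "r - scale (\<phi> r) 1 = 0" for r by (metis right_minus_eq)
  then show "max_ideal {0}" unfolding max_ideal_def using is_ideal_zero by auto
next
  assume m: "max_ideal {0}"
  have inj: "scale c 1 = scale d 1 \<Longrightarrow> c = d" for c d
    using max_ideal_scale_one[OF m, of "c - d"] by (simp add: scale_left_diff_distrib)
  have "\<forall>r. \<exists>c. r = scale c 1" using m unfolding max_ideal_def by auto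
  then obtain \<phi> where \<phi>: "\<And>r. r = scale (\<phi> r) 1" by metis
  have \<phi>I: "\<phi> r = c" if "r = scale c 1" for r c using \<phi>[of r] that inj by metis
  have "inj \<phi>" by (rule injI) (metis \<phi>)
  moreover have "surj \<phi>" by (rule surjI[of _ "\<lambda>c. scale c 1"]) (rule \<phi>I, rule refl)
  moreover have "\<phi> 1 = 1" by (rule \<phi>I) simp
  moreover have "\<phi> (x + y) = \<phi> x + \<phi> y" for x y
    by (rule \<phi>I) (metis \<phi> scale_left_distrib)
  moreover have "\<phi> (x * y) = \<phi> x * \<phi> y" for x y
  proof (rule \<phi>I)
    have "x * y = scale (\<phi> x) 1 * scale (\<phi> y) 1" using \<phi>[of x] \<phi>[of y] by simp
    then show "x * y = scale (\<phi> x * \<phi> y) 1" by (simp add: scale_mult_left mult_scale_right)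
  qed
  moreover have "\<phi> (scale c x) = c * \<phi> x" for c x
    by (rule \<phi>I) (metis \<phi> scale_scale)
  ultimately show "algebra_isomorphic scale ((*) :: 'k \<Rightarrow> 'k \<Rightarrow> 'k)"
    unfolding algebra_isomorphic_def bij_def by blast
qed

text \<open>Products within m vanish, so any basis of m, indexed by the variables, has the right
  multiplication table.\<close>

lemma ex_monomial_basis_linear:
  assumes m: "max_ideal m" and dim: "dim m = CARD('v::finite)"
    and zero: "\<And>x y. x \<in> m \<Longrightarrow> y \<in> m \<Longrightarrow> x * y = 0"
  shows "\<exists>b. monomial_basis (linear_exponents :: ('v \<Rightarrow>\<^sub>0 nat) set) b"
proof -
  have mi: "is_ideal m" using m unfolding max_ideal_def by blast
  obtain B where B: "B \<subseteq> m" "independent B" "m \<subseteq> span B" "card B = dim m"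
    using basis_exists[of m] by metis
  have "finite B" using B(2) by (rule finiteI_independent)
  then obtain f :: "'v \<Rightarrow> 'r" where f: "bij_betw f UNIV B"
    using B(4) dim finite_same_card_bij[of "UNIV :: 'v set" B] by auto
  have fm: "f v \<in> m" for v using f B(1) by (auto simp: bij_betw_def)
  define b where "b s = (if s = 0 then 1 else f (THE v. s = Poly_Mapping.single v 1))" for s :: "'v \<Rightarrow>\<^sub>0 nat"
  have b_single: "b (Poly_Mapping.single v 1) = f v" for v
    unfolding b_def using single_one_neq_0[of v] by (simp only: single_one_eq_iff if_False) simp
  have b0: "b 0 = 1" unfolding b_def by simp
  have "monomial_basis linear_exponents b"
  proof (rule monomial_basisI)
    show "card (linear_exponents :: ('v \<Rightarrow>\<^sub>0 nat) set) = dimension"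
      by (simp add: card_linear_exponents dimension_max_ideal[OF m] dim)
    have "b ` linear_exponents = insert 1 B"
      unfolding linear_exponents_def using f by (simp add: image_image b_single b0 bij_betw_def del: One_nat_def)
    moreover have "insert 1 m \<subseteq> span (insert 1 B)"
      using B(3) span_mono[of B "insert 1 B"] by (auto simp: span_base)
    then have "span (insert 1 m) \<subseteq> span (insert 1 B)" by (rule span_minimal) simp
    ultimately show "span (b ` linear_exponents) = UNIV" using max_ideal_span[OF m] by auto
    fix s t :: "'v \<Rightarrow>\<^sub>0 nat" assume st: "s \<in> linear_exponents" "t \<in> linear_exponents"
    show "b s * b t = (if s + t \<in> linear_exponents then b (s + t) else 0)"
    proof (cases "s = 0 \<or> t = 0")
      case True
      then show ?thesis using st by (auto simp: b0)
    next
      case False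
      then obtain v w where vw: "s = Poly_Mapping.single v 1" "t = Poly_Mapping.single w 1"
        using st unfolding linear_exponents_def by auto
      have "s + t \<notin> linear_exponents" by (rule add_notin_linear_exponents) (use False in auto)
      moreover have "b s * b t = 0" unfolding vw b_single by (rule zero[OF fm fm])
      ultimately show ?thesis by simp
    qed
  qed (simp_all add: b0 finite_linear_exponents)
  then show ?thesis by blast
qed

lemma independent_mod_subspace:
  assumes P: "subspace P" and "x \<notin> P" "y \<notin> span (insert x P)" and mem: "scale a x + scale b y \<in> P"
  shows "a = 0 \<and> b = 0"
proof -
  have "b = 0"
  proof (rule ccontr)
    assume "b \<noteq> 0"
    then have "y = scale (inverse b) ((scale a x + scale b y) - scale a x)" by simp
    also have "\<dots> \<in> span (insert x P)" using mem by (intro span_scale span_diff span_base) auto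
    finally show False using assms(3) by blast
  qed
  moreover have "a = 0"
  proof (rule ccontr)
    assume "a \<noteq> 0"
    then have "x = scale (inverse a) (scale a x + scale b y)" using \<open>b = 0\<close> by simp
    then show False using subspace_scale[OF P mem] \<open>x \<notin> P\<close> by metis
  qed
  ultimately show ?thesis by blast
qed

end

context alg_closed_comm_algebra
begin

text \<open>With m = Ku + Kv + P and mP = 0, only products of \<open>u\<close> and \<open>v\<close>
  survive in m^2.\<close>

lemma square_of_two_generated:
  assumes P: "P = prod_mod m m {0}" and cube: "\<And>x p. x \<in> m \<Longrightarrow> p \<in> P \<Longrightarrow> x * p = 0"
    and uv: "u \<in> m" "v \<in> m" and Pm: "P \<subseteq> m" and gen: "m \<subseteq> span (insert v (insert u P))"
  shows "P \<subseteq> span {u * u, u * v, v * v}"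
proof -
  have "x * y \<in> span {u * u, u * v, v * v}" if "x \<in> m" "y \<in> m" for x y
  proof (rule span_mult_mem[OF subspace_span _ subsetD[OF gen that(1)] subsetD[OF gen that(2)]])
    fix a b assume ab: "a \<in> insert v (insert u P)" "b \<in> insert v (insert u P)"
    have am: "a \<in> m" "b \<in> m" using ab uv Pm by auto
    consider "a \<in> P \<or> b \<in> P" | "a \<in> {u, v}" "b \<in> {u, v}" using ab by blast
    then show "a * b \<in> span {u * u, u * v, v * v}"
    proof cases
      case 1
      then have "a * b = 0" using cube[of a b] cube[of b a] am by (auto simp: mult.commute)
      then show ?thesis by (simp add: span_zero)
    next
      case 2
      then have "a * b \<in> {u * u, u * v, v * v}" by (auto simp: mult.commute)
      then show ?thesis by (rule span_base)
    qed
  qed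
  then show ?thesis unfolding P by (intro prod_mod_minimal) (auto simp: span_zero)
qed

text \<open>A binary quadratic form is a product of linear forms, so the one relation between
  \<open>x\<^sup>2\<close>, \<open>x y\<close> and \<open>y\<^sup>2\<close> is a vanishing product.\<close>

lemma ex_vanishing_product:
  assumes "subspace P" "dim P = 2" and P: "P \<subseteq> span {x * x, x * y, y * y}" "x * x \<in> P" "x * y \<in> P" "y * y \<in> P"
    and x: "x \<notin> P" and y: "y \<notin> span (insert x P)"
  obtains a b c d where "(scale a x + scale b y) * (scale c x + scale d y) = 0"
    "scale a x + scale b y \<notin> P" "scale c x + scale d y \<notin> P"
proof -
  note ind = independent_mod_subspace[OF \<open>subspace P\<close> x y]
  consider (a) "x * y \<in> span {y * y}" | (b) "y * y = 0" | (c) "x * y \<notin> span {y * y}" "y * y \<noteq> 0" by blast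
  then show thesis
  proof cases
    case a
    then obtain t where t: "x * y = scale t (y * y)" by (auto simp: span_singleton)
    \<comment> \<open>The relation says (x - t y) y = 0.\<close>
    show thesis
    proof (rule that[of 1 "- t" 0 1])
      show "(scale 1 x + scale (- t) y) * (scale 0 x + scale 1 y) = 0"
        by (simp add: algebra_simps mult_scale_right t)
    qed (use ind[of 1 "- t"] ind[of 0 1] in auto)
  next
    case b
    then show thesis using that[of 0 1 0 1] ind[of 0 1] by auto
  next
    case c
    \<comment> \<open>Now x y and y^2 form a basis of P, so x^2 = r x y + s y^2. This factors as
      soon as T^2 - r T - s has a root t, the other root being r - t.\<close>
    have "dim {x * y, y * y} = 2" using c by (simp add: dim_insert)
    then have "span {x * y, y * y} = P"
      using P \<open>subspace P\<close> \<open>dim P = 2\<close> by (intro subspace_dim_equal span_minimal) auto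
    then obtain r s where rs: "x * x - scale r (x * y) = scale s (y * y)"
      using P(2) by (auto simp: span_breakdown_eq span_singleton)
    obtain t where "poly [:- s, - r, 1:] t = 0" using alg_closed_imp_poly_has_root[of "[:- s, - r, 1:]"] by auto
    then have t: "s = t * (t - r)" by (simp add: algebra_simps)
    have "(scale 1 x + scale (- t) y) * (scale 1 x + scale (t - r) y)
      = x * x + scale (t - r) (x * y) - scale t (x * y) - scale (t * (t - r)) (y * y)"
      by (simp add: algebra_simps scale_mult_left mult_scale_right)
    also have "\<dots> = x * x - scale r (x * y) - scale (t * (t - r)) (y * y)"
      by (simp add: scale_left_diff_distrib)
    also have "\<dots> = 0" using rs t by simp
    finally show thesis using that[of 1 "- t" 1 "t - r"] ind[of 1 "- t"] ind[of 1 "t - r"] by auto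
  qed
qed

text \<open>Let u v = 0 be the vanishing product. If u and v are independent modulo
  \<open>P\<close>, they serve as x and y. Otherwise v = k u + p with k nonzero and p in
  \<open>P\<close>; then u p = 0 gives u^2 = 0, and u together with any w independent of it modulo
  \<open>P\<close> serves as x and y.\<close>

lemma ex_monomial_basis_two_two:
  assumes m: "max_ideal m" and P_def: "P = prod_mod m m {0}"
    and cube: "\<And>x p. x \<in> m \<Longrightarrow> p \<in> P \<Longrightarrow> x * p = 0"
    and dim: "dim m = 4" "dim P = 2"
  shows "(\<exists>b. monomial_basis xy_exponents b) \<or> (\<exists>b. monomial_basis xx_exponents b)"
proof -
  have mi: "is_ideal m" using m unfolding max_ideal_def by blast
  have sm: "subspace m" using subspace_ideal[OF mi] .
  have sP: "subspace P" unfolding P_def by (intro subspace_ideal is_ideal_prod_mod mi is_ideal_zero)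
  have mm: "x * y \<in> P" if "x \<in> m" "y \<in> m" for x y unfolding P_def using that by (rule prod_mod_mult)
  have Pm: "P \<subseteq> m"
    unfolding P_def using is_idealD(1,3)[OF mi] by (intro prod_mod_minimal sm) auto
  have gen: "m \<subseteq> span (insert v (insert u P))"
    if "u \<in> m" "v \<in> m" "u \<notin> P" "v \<notin> span (insert u P)" for u v
  proof -
    have "dim (span (insert v (insert u P))) = 4" 
      using that dim by (simp add: dim_insert span_eq_iff[THEN iffD2, OF sP])
    moreover have "span (insert v (insert u P)) \<subseteq> m" using that Pm sm by (intro span_minimal) auto
    ultimately have "span (insert v (insert u P)) = m" using dim sm by (intro subspace_dim_equal) auto
    then show ?thesis by simp
  qed
  have basis_span: "span {1, u, v, a, b} = UNIV"
    if "m \<subseteq> span (insert v (insert u P))" "P \<subseteq> span {a, b}" for u v a b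
  proof -
    let ?S = "{1, u, v, a, b}"
    have "P \<subseteq> span ?S" using that(2) span_mono[of "{a, b}" ?S] by auto
    then have "span (insert v (insert u P)) \<subseteq> span ?S" by (intro span_minimal) (auto intro: span_base)
    then have "span (insert 1 m) \<subseteq> span ?S" using that(1) by (intro span_minimal) (auto intro: span_base)
    then show ?thesis using max_ideal_span[OF m] by auto
  qed
  have other: "\<exists>v\<in>m. v \<notin> span (insert u P)" if "u \<in> m" "u \<notin> P" for u
  proof (rule ccontr)
    assume "\<not> ?thesis"
    then have "dim m \<le> dim (span (insert u P))" by (intro dim_subset) blast
    then show False using dim dim_span_insert[OF sP that(2)] by simp
  qed
  have "P \<noteq> m" using dim by auto
  then obtain x where x: "x \<in> m" "x \<notin> P" using Pm by blast
  then obtain y where y: "y \<in> m" "y \<notin> span (insert x P)" using other by blast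
  have xy: "P \<subseteq> span {x * x, x * y, y * y}"
    using square_of_two_generated[OF P_def cube x(1) y(1) Pm gen[OF x(1) y(1) x(2) y(2)]] .
  obtain c1 c2 c3 c4 where c: "(scale c1 x + scale c2 y) * (scale c3 x + scale c4 y) = 0"
    "scale c1 x + scale c2 y \<notin> P" "scale c3 x + scale c4 y \<notin> P"
    using ex_vanishing_product[OF sP dim(2) xy mm[OF x(1) x(1)] mm[OF x(1) y(1)] mm[OF y(1) y(1)] x(2) y(2)] .
  define u where "u = scale c1 x + scale c2 y"
  define v where "v = scale c3 x + scale c4 y"
  have uv: "u * v = 0" "u \<notin> P" "v \<notin> P" using c unfolding u_def v_def .
  have um: "u \<in> m" and vm: "v \<in> m"
    unfolding u_def v_def using x y sm by (auto intro: subspace_add subspace_scale)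
  \<comment> \<open>Monomials in u and a second element, which will be v or w.\<close>
  define b where "b y s = u ^ Poly_Mapping.lookup s 0 * y ^ Poly_Mapping.lookup s 1"
    for y and s :: "2 \<Rightarrow>\<^sub>0 nat"
  have b_add: "b y (s + t) = b y s * b y t" for y s t
    by (simp add: b_def lookup_add power_add mult_ac)
  \<comment> \<open>Monomials multiply correctly anyway, so the table only requires that they vanish
    outside \<open>D\<close>, which can be checked on the generators of the monomial ideal.\<close>
  have b_mult: "b y s * b y t = (if s + t \<in> D then b y (s + t) else 0)"
    if "\<And>s. s \<notin> D \<Longrightarrow> b y s = 0" for y s t D
    using that by (simp add: b_add[symmetric])
  have cube_pow: "z ^ 3 = 0" if "z \<in> m" for z
    using cube[OF that mm[OF that that]] by (simp add: power3_eq_cube mult.assoc)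
  show ?thesis
  proof (cases "v \<in> span (insert u P)")
    case False
    have g: "m \<subseteq> span (insert v (insert u P))" using gen[OF um vm uv(2) False] .
    have "P \<subseteq> span {u * u, 0, v * v}"
      using square_of_two_generated[OF P_def cube um vm Pm g] uv(1) by simp
    then have P: "P \<subseteq> span {u * u, v * v}" by (simp add: insert_commute)
    have "b v s = 0" if s: "s \<notin> xy_exponents" for s
    proof -
      obtain g w where g: "g \<in> {expo 1 1, expo 3 0, expo 0 3}" "s = w + g" using xy_exponents_compl[OF s] by blast
      then have "b v g = 0" using uv(1) cube_pow um vm by (auto simp: b_def)
      then show ?thesis unfolding g(2) b_add by simp
    qed
    then have "monomial_basis xy_exponents (b v)"
    proof (intro monomial_basisI b_mult)
      have "b v ` xy_exponents = {1, u, v, u * u, v * v}"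
        by (auto simp: xy_exponents_def b_def power2_eq_square)
      then show "span (b v ` xy_exponents) = UNIV" using basis_span[OF g P] by simp
    qed (auto simp: dimension_max_ideal[OF m] dim card_xy_exponents b_def xy_exponents_def)
    then show ?thesis by blast
  next
    case True
    then obtain k where k: "v - scale k u \<in> P" using span_insert_subspace[OF sP] by blast
    have "k \<noteq> 0" using k uv(3) by auto
    have "u * (v - scale k u) = 0" using cube[OF um k] .
    then have "scale k (u * u) = 0" using uv(1) by (simp add: algebra_simps mult_scale_right)
    then have uu: "u * u = 0" using \<open>k \<noteq> 0\<close> by simp
    obtain w where w: "w \<in> m" "w \<notin> span (insert u P)" using other[OF um uv(2)] by blast
    have g: "m \<subseteq> span (insert w (insert u P))" using gen[OF um w(1) uv(2) w(2)] .
    have "P \<subseteq> span {0, u * w, w * w}"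
      using square_of_two_generated[OF P_def cube um w(1) Pm g] uu by simp
    then have P: "P \<subseteq> span {u * w, w * w}" by simp
    have "b w s = 0" if s: "s \<notin> xx_exponents" for s
    proof -
      obtain g t where g: "g \<in> {expo 2 0, expo 1 2, expo 0 3}" "s = t + g" using xx_exponents_compl[OF s] by blast
      then have "b w g = 0"
        using uu cube_pow[OF w(1)] cube[OF um mm[OF w(1) w(1)]] by (auto simp: b_def power2_eq_square)
      then show ?thesis unfolding g(2) b_add by simp
    qed
    then have "monomial_basis xx_exponents (b w)"
    proof (intro monomial_basisI b_mult)
      have "b w ` xx_exponents = {1, u, w, u * w, w * w}"
        by (auto simp: xx_exponents_def b_def power2_eq_square)
      then show "span (b w ` xx_exponents) = UNIV" using basis_span[OF g P] by simp
    qed (auto simp: dimension_max_ideal[OF m] dim card_xx_exponents b_def xx_exponents_def)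
    then show ?thesis by blast
  qed
qed

section \<open>Recognising the losing algebras by their monomial bases\<close>

lemma monomial_basis_linear_imp_losing:
  assumes b: "monomial_basis (linear_exponents :: ('v::finite \<Rightarrow>\<^sub>0 nat) set) b"
    and "CARD('v) = 2 \<or> CARD('v) = 4"
  shows "losing {0}"
proof (rule monomial_basis_imp_losing[OF finite_linear_exponents _ b])
  show "{} = {u \<in> linear_exponents. \<exists>s\<in>linear_exponents - {0}. \<exists>t\<in>linear_exponents - {0}. u = s + (t :: 'v \<Rightarrow>\<^sub>0 nat)}"
    using add_notin_linear_exponents by fastforce
qed (use assms(2) in \<open>auto simp: card_linear_exponents zero_in_linear_exponents\<close>)

lemma monomial_basis_xy_imp_losing:
  assumes "monomial_basis xy_exponents b" shows "losing {0}"
proof (rule monomial_basis_imp_losing[OF _ _ assms])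
  have *: "xy_exponents - {0} = {expo 1 0, expo 0 1, expo 2 0, expo 0 2}"
    unfolding xy_exponents_def expo_0[symmetric] by auto
  show "{expo 2 0, expo 0 2} =
      {u \<in> xy_exponents. \<exists>s\<in>xy_exponents - {0}. \<exists>t\<in>xy_exponents - {0}. u = s + t}"
    unfolding * by (auto simp: xy_exponents_def)
  show "s + u \<notin> xy_exponents" if "s \<in> xy_exponents - {0}" "u \<in> {expo 2 0, expo 0 2}" for s u
    using that unfolding * by (auto simp: xy_exponents_def)
qed (simp_all add: card_xy_exponents, simp_all add: xy_exponents_def expo_0)

lemma monomial_basis_xx_imp_losing:
  assumes "monomial_basis xx_exponents b" shows "losing {0}"
proof (rule monomial_basis_imp_losing[OF _ _ assms])
  have *: "xx_exponents - {0} = {expo 1 0, expo 0 1, expo 1 1, expo 0 2}"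
    unfolding xx_exponents_def expo_0[symmetric] by auto
  show "{expo 1 1, expo 0 2} =
      {u \<in> xx_exponents. \<exists>s\<in>xx_exponents - {0}. \<exists>t\<in>xx_exponents - {0}. u = s + t}"
    unfolding * by (auto simp: xx_exponents_def)
  show "s + u \<notin> xx_exponents" if "s \<in> xx_exponents - {0}" "u \<in> {expo 1 1, expo 0 2}" for s u
    using that unfolding * by (auto simp: xx_exponents_def)
qed (simp_all add: card_xx_exponents, simp_all add: xx_exponents_def expo_0)

lemma losing_zero_iff:
  "losing {0} \<longleftrightarrow>
    max_ideal {0} \<or> (\<exists>b. monomial_basis (linear_exponents :: (2 \<Rightarrow>\<^sub>0 nat) set) b) \<or>
    (\<exists>b. monomial_basis xy_exponents b) \<or> (\<exists>b. monomial_basis xx_exponents b) \<or>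
    (\<exists>b. monomial_basis (linear_exponents :: (4 \<Rightarrow>\<^sub>0 nat) set) b)" (is "_ \<longleftrightarrow> ?R")
proof
  assume "losing {0}"
  then obtain m where m: "max_ideal m" "losing_at m {0}" unfolding losing_def by blast
  define P where "P = prod_mod m m {0}"
  have mm: "x * y \<in> P" if "x \<in> m" "y \<in> m" for x y unfolding P_def using that by (rule prod_mod_mult)
  consider "m = {0}" | "P = {0}" "dim m = 2" | "P = {0}" "dim m = 4"
    | "\<And>x p. x \<in> m \<Longrightarrow> p \<in> P \<Longrightarrow> x * p = 0" "dim m = 4" "dim P = 2"
    using m(2) unfolding losing_at_def Let_def P_def[symmetric] by auto
  then show ?R
  proof cases
    case 1
    then show ?thesis using m by simp
  next
    case 2
    then show ?thesis using ex_monomial_basis_linear[OF m(1), where 'v = 2] mm by auto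
  next
    case 3
    then show ?thesis using ex_monomial_basis_linear[OF m(1), where 'v = 4] mm by auto
  next
    case 4
    then show ?thesis using ex_monomial_basis_two_two[OF m(1) P_def] by blast
  qed
next
  assume ?R
  then show "losing {0}"
    using losing_max_ideal monomial_basis_linear_imp_losing[where 'v = 2]
      monomial_basis_linear_imp_losing[where 'v = 4]
      monomial_basis_xy_imp_losing monomial_basis_xx_imp_losing by auto
qed

lemma isomorphic_to_quotient_iff:
  assumes "finite D" "down_closed D" "0 \<in> D"
  shows "isomorphic_to_quotient mscale (coeffs_vanish D :: ('v, 'k) mpolys set) scale \<longleftrightarrow>
    (\<exists>b. monomial_basis D b)"
  using isomorphic_to_quotient_imp_monomial_basis[OF assms(1,2)]
    monomial_basis_imp_isomorphic_to_quotient[OF assms] by metis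

end

theorem theorem1p0p2:
  fixes scale :: "'k::alg_closed_field \<Rightarrow> 'r::comm_ring_1 \<Rightarrow> 'r"
  assumes "comm_algebra scale"
    and "1 \<le> algebra_rank scale" and "algebra_rank scale \<le> 6"
  shows "alice_wins TYPE('r) \<longleftrightarrow>
    \<not> (algebra_isomorphic scale ((*) :: 'k \<Rightarrow> 'k \<Rightarrow> 'k) \<or>
       isomorphic_to_quotient mscale (ideal_xy_squared :: (2, 'k) mpolys set) scale \<or>
       isomorphic_to_quotient mscale (ideal_xy_x3_y3 :: (2, 'k) mpolys set) scale \<or>
       isomorphic_to_quotient mscale (ideal_x2_xy2_y3 :: (2, 'k) mpolys set) scale \<or>
       isomorphic_to_quotient mscale (ideal_xyzw_squared :: (4, 'k) mpolys set) scale)"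
proof -
  interpret comm_algebra scale by fact
  obtain B where B: "independent B" "span B = UNIV" "card B = dim UNIV"
    using basis_exists[of UNIV] by (metis top.extremum_uniqueI)
  \<comment> \<open>An infinite basis would have \<open>card\<close> 0, so rank at least 1 forces a
    finite one.\<close>
  then have "finite B" using assms(2) by (metis card.infinite not_one_le_zero)
  then interpret alg_closed_comm_algebra scale B
    using B by unfold_locales auto
  have "dimension \<le> 6" using assms(3) by (simp add: dimension_def)
  from alice_wins_iff_not_losing[OF this] show ?thesis
    unfolding losing_zero_iff algebra_isomorphic_field_iff ideal_xy_squared_eq ideal_xyzw_squared_eq
      ideal_xy_x3_y3_eq ideal_x2_xy2_y3_eq
    using isomorphic_to_quotient_iff[where 'v = 2,
        OF finite_linear_exponents down_closed_linear_exponents zero_in_linear_exponents]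
      isomorphic_to_quotient_iff[where 'v = 4,
        OF finite_linear_exponents down_closed_linear_exponents zero_in_linear_exponents]
      isomorphic_to_quotient_iff[OF _ down_closed_xy_exponents] isomorphic_to_quotient_iff[OF _ down_closed_xx_exponents]
    by (simp add: finite_xy_exponents finite_xx_exponents zero_in_xy_exponents zero_in_xx_exponents)
qed

end
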